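(* Let $B=\bigoplus_{i\ge 0}B^i$ be a connected, finite-dimensional, graded vector space over an algebraically closed field $\Bbbk$. For each $i\ge 1$, let $$U^i_B=\{A\in P_B\mid \mathcal{R}^i_1(A)\subseteq\{0\}\}$$ be the set of commutative graded algebras whose underlying graded vector space is $B$ and whose degree $i$ resonance varieties are trivial. Then $U^i_B$ is a Zariski open subset of $P_B$.
   Context: Connected means $B^0=\Bbbk$. A cga is a (unital, associative) graded-commutative graded $\Bbbk$-algebra $A=\bigoplus_{i\ge0}A^i$, i.e. $ab=(-1)^{ij}ba$ for $a\in A^i$, $b\in A^j$; all cgas are assumed connected, $A^0=\Bbbk$. $P_B$ is the parameter space of all cga structures with underlying graded vector space $B$. A point $A\in P_B$ is given by its multiplication maps in positive degrees, so $P_B$ is a subset of the finite-dimensional vector space $V_B=\bigoplus_{i,j\ge1}\mathrm{Hom}_\Bbbk(B^i\otimes B^j,B^{i+j})$, cut out by the homogeneous quadratic equations expressing associativity and the linear equations expressing graded-commutativity. It carries the Zariski topology as a closed subset of the affine space $V_B$. For a connected cga $A$ and $a\in A^1$ with $a^2=0$, $(A,\delta(a))$ is the cochain complex with terms $A^i$ and differentials $\delta^i(a)(b)=ab$ for $b\in A^i$. The resonance varieties of $A$ are $\mathcal{R}^i_d(A)=\{a\in A^1\mid a^2=0,\ \dim_\Bbbk H^i(A,\delta(a))\ge d\}$. *)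

theory Defs
  imports
    "HOL-Library.Function_Algebras"
    "HOL-Computational_Algebra.Polynomial"
    "HOL-Analysis.Abstract_Topology"
    "Jordan_Normal_Form.VS_Connect"
begin

section \<open>The Zariski topology on a finite-dimensional vector space\<close>

text \<open>
  The coordinate ring of a vector space \<open>V\<close> (a subspace of an ambient type) is taken basis-free: it
  is generated, as an algebra of functions, by the constants and the linear functionals on \<open>V\<close>.
  Values outside \<open>V\<close> are irrelevant.
\<close>

definition linear_functional_on ::
  "('k::field \<Rightarrow> 'x::ab_group_add \<Rightarrow> 'x) \<Rightarrow> 'x set \<Rightarrow> ('x \<Rightarrow> 'k) \<Rightarrow> bool" where
  "linear_functional_on scl V f \<longleftrightarrow>
     (\<forall>x\<in>V. \<forall>y\<in>V. f (x + y) = f x + f y) \<and> (\<forall>c. \<forall>x\<in>V. f (scl c x) = c * f x)"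

inductive_set poly_funs ::
  "('k::field \<Rightarrow> 'x::ab_group_add \<Rightarrow> 'x) \<Rightarrow> 'x set \<Rightarrow> ('x \<Rightarrow> 'k) set"
  for scl V where
  const: "(\<lambda>_. c) \<in> poly_funs scl V"
| linear: "linear_functional_on scl V f \<Longrightarrow> f \<in> poly_funs scl V"
| add: "f \<in> poly_funs scl V \<Longrightarrow> g \<in> poly_funs scl V \<Longrightarrow> (\<lambda>x. f x + g x) \<in> poly_funs scl V"
| mult: "f \<in> poly_funs scl V \<Longrightarrow> g \<in> poly_funs scl V \<Longrightarrow> (\<lambda>x. f x * g x) \<in> poly_funs scl V"

definition zero_locus :: "'x set \<Rightarrow> ('x \<Rightarrow> 'k::field) set \<Rightarrow> 'x set" where
  "zero_locus V F = {x \<in> V. \<forall>f\<in>F. f x = 0}"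

definition zariski ::
  "('k::field \<Rightarrow> 'x::ab_group_add \<Rightarrow> 'x) \<Rightarrow> 'x set \<Rightarrow> 'x topology" where
  "zariski scl V = topology (\<lambda>U. \<exists>F \<subseteq> poly_funs scl V. U = V - zero_locus V F)"

lemma in_Diff_zero_locus: "x \<in> V - zero_locus V F \<longleftrightarrow> x \<in> V \<and> (\<exists>f\<in>F. f x \<noteq> 0)"
  by (auto simp: zero_locus_def)

lemma istopology_zariski:
  "istopology (\<lambda>U. \<exists>F \<subseteq> poly_funs scl V. U = V - zero_locus V F)"
  unfolding istopology_def
proof (intro conjI allI impI)
  fix S T
  assume "\<exists>F \<subseteq> poly_funs scl V. S = V - zero_locus V F"
    and "\<exists>F \<subseteq> poly_funs scl V. T = V - zero_locus V F"
  then obtain F G where F: "F \<subseteq> poly_funs scl V" "S = V - zero_locus V F"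
    and G: "G \<subseteq> poly_funs scl V" "T = V - zero_locus V G"
    by blast
  define H where "H = (\<lambda>(f, g) x. f x * g x) ` (F \<times> G)"
  have "H \<subseteq> poly_funs scl V"
  proof
    fix h assume "h \<in> H"
    then obtain f g where "h = (\<lambda>x. f x * g x)" "f \<in> F" "g \<in> G"
      by (auto simp: H_def)
    with F(1) G(1) show "h \<in> poly_funs scl V"
      by (simp add: poly_funs.mult subset_iff)
  qed
  moreover have "S \<inter> T = V - zero_locus V H"
  proof (rule Set.set_eqI)
    fix x
    have "(\<exists>h\<in>H. h x \<noteq> 0) \<longleftrightarrow> (\<exists>f\<in>F. \<exists>g\<in>G. f x * g x \<noteq> 0)"
      by (simp add: H_def)
    then show "x \<in> S \<inter> T \<longleftrightarrow> x \<in> V - zero_locus V H"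
      unfolding Int_iff F(2) G(2) in_Diff_zero_locus by auto
  qed
  ultimately show "\<exists>F \<subseteq> poly_funs scl V. S \<inter> T = V - zero_locus V F"
    by (intro exI[of _ H] conjI)
next
  fix \<K>
  assume "\<forall>K\<in>\<K>. \<exists>F \<subseteq> poly_funs scl V. K = V - zero_locus V F"
  then have "\<exists>F. \<forall>K\<in>\<K>. F K \<subseteq> poly_funs scl V \<and> K = V - zero_locus V (F K)"
    by (intro bchoice)
  then obtain F where F: "\<forall>K\<in>\<K>. F K \<subseteq> poly_funs scl V \<and> K = V - zero_locus V (F K)"
    by (elim exE)
  have "x \<in> K \<longleftrightarrow> x \<in> V \<and> (\<exists>f\<in>F K. f x \<noteq> 0)" if "K \<in> \<K>" for x K
  proof -
    have "x \<in> K \<longleftrightarrow> x \<in> V - zero_locus V (F K)"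
      using F that by metis
    then show ?thesis
      by (simp only: in_Diff_zero_locus)
  qed
  then have "x \<in> \<Union>\<K> \<longleftrightarrow> (\<exists>K\<in>\<K>. x \<in> V \<and> (\<exists>f\<in>F K. f x \<noteq> 0))" for x
    by (simp cong: bex_cong)
  then have "x \<in> \<Union>\<K> \<longleftrightarrow> x \<in> V - zero_locus V (\<Union>K\<in>\<K>. F K)" for x
    unfolding in_Diff_zero_locus by auto
  then have "\<Union>\<K> = V - zero_locus V (\<Union>K\<in>\<K>. F K)"
    by (rule Set.set_eqI)
  moreover have "(\<Union>K\<in>\<K>. F K) \<subseteq> poly_funs scl V"
    using F by (simp add: UN_subset_iff)
  ultimately show "\<exists>F \<subseteq> poly_funs scl V. \<Union>\<K> = V - zero_locus V F"
    by (intro exI[of _ "\<Union>K\<in>\<K>. F K"] conjI)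
qed

lemma openin_zariski:
  "openin (zariski scl V) U \<longleftrightarrow> (\<exists>F \<subseteq> poly_funs scl V. U = V - zero_locus V F)"
  by (simp add: zariski_def topology_inverse'[OF istopology_zariski])

lemma topspace_zariski: "topspace (zariski scl V) = V"
proof (rule equalityI)
  have "openin (zariski scl V) (topspace (zariski scl V))"
    by (rule openin_topspace)
  then show "topspace (zariski scl V) \<subseteq> V"
    unfolding openin_zariski by auto
  have "openin (zariski scl V) V"
    unfolding openin_zariski
    by (rule exI[of _ "{\<lambda>_. 1}"]) (auto simp: zero_locus_def intro: poly_funs.const)
  then show "V \<subseteq> topspace (zariski scl V)"
    by (rule openin_subset)
qed

lemma closedin_zariski:
  "closedin (zariski scl V) C \<longleftrightarrow> (\<exists>F \<subseteq> poly_funs scl V. C = zero_locus V F)"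
proof -
  have "C \<subseteq> V \<and> V - C = V - zero_locus V F \<longleftrightarrow> C = zero_locus V F" for F
  proof -
    have "zero_locus V F \<subseteq> V" by (auto simp: zero_locus_def)
    then show ?thesis by blast
  qed
  then show ?thesis
    unfolding closedin_def topspace_zariski openin_zariski by metis
qed


section \<open>Quotient spaces\<close>

text \<open>
  The vector space \<open>Z / W\<close> of cosets \<open>z + W\<close>. The ring multiplication and unit in the record
  \<^typ>\<open>('k, 'v set) module\<close> play no role for vector spaces.
\<close>

definition quotient_space ::
  "('k::field \<Rightarrow> 'v::ab_group_add \<Rightarrow> 'v) \<Rightarrow> 'v set \<Rightarrow> 'v set \<Rightarrow> ('k, 'v set) module" where
  "quotient_space scl Z W =
     \<lparr> carrier = (\<lambda>z. (\<lambda>w. z + w) ` W) ` Z,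
       mult = undefined, one = undefined,
       zero = W,
       add = (\<lambda>X Y. {x + y | x y. x \<in> X \<and> y \<in> Y}),
       smult = (\<lambda>c X. {scl c x + w | x w. x \<in> X \<and> w \<in> W}) \<rparr>"


lemma (in vector_space) vectorspace_quotient_space:
  assumes Z: "subspace Z" and W: "subspace W"
  shows "vectorspace (class_ring :: 'a ring) (quotient_space scale Z W)"
proof -
  let ?Q = "quotient_space scale Z W"
  define k where "k z = (\<lambda>w. z + w) ` W" for z
  have memI: "z + w \<in> k z" if "w \<in> W" for z w
    using that by (simp add: k_def)
  have memE: "\<exists>w\<in>W. x = z + w" if "x \<in> k z" for x z
    using that by (auto simp: k_def)
  have W0: "0 \<in> W" and Z0: "0 \<in> Z"
    by (rule subspace_0[OF W], rule subspace_0[OF Z])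
  have car: "carrier ?Q = k ` Z" and zero: "\<zero>\<^bsub>?Q\<^esub> = k 0"
    by (simp_all add: quotient_space_def k_def)
  have add_iff: "t \<in> X \<oplus>\<^bsub>?Q\<^esub> Y \<longleftrightarrow> (\<exists>x\<in>X. \<exists>y\<in>Y. t = x + y)" for t X Y
    by (auto simp: quotient_space_def)
  have smult_iff: "t \<in> c \<odot>\<^bsub>?Q\<^esub> X \<longleftrightarrow> (\<exists>x\<in>X. \<exists>w\<in>W. t = c *s x + w)" for t c X
    by (auto simp: quotient_space_def)
  have add: "k x \<oplus>\<^bsub>?Q\<^esub> k y = k (x + y)" for x y
  proof (intro equalityI subsetI)
    fix t assume "t \<in> k x \<oplus>\<^bsub>?Q\<^esub> k y"
    then obtain p q where "p \<in> k x" "q \<in> k y" "t = p + q"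
      unfolding add_iff by blast
    with memE[of p x] memE[of q y] obtain w w' where w: "w \<in> W" "w' \<in> W" "t = (x + w) + (y + w')"
      by blast
    have "t = (x + y) + (w + w')"
      unfolding w(3) by (simp add: ac_simps)
    with memI[OF subspace_add[OF W w(1,2)]] show "t \<in> k (x + y)" by metis
  next
    fix t assume "t \<in> k (x + y)"
    then obtain w where w: "w \<in> W" "t = (x + y) + w" using memE by blast
    have "t = (x + w) + (y + 0)" unfolding w(2) by (simp add: ac_simps)
    with memI[OF w(1)] memI[OF W0] show "t \<in> k x \<oplus>\<^bsub>?Q\<^esub> k y"
      unfolding add_iff by blast
  qed
  have smult: "c \<odot>\<^bsub>?Q\<^esub> k x = k (c *s x)" for c x
  proof (intro equalityI subsetI)
    fix t assume "t \<in> c \<odot>\<^bsub>?Q\<^esub> k x"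
    then obtain p w' where "p \<in> k x" "w' \<in> W" "t = c *s p + w'"
      unfolding smult_iff by blast
    with memE[of p x] obtain w where w: "w \<in> W" "w' \<in> W" "t = c *s (x + w) + w'"
      by blast
    have "t = c *s x + (c *s w + w')"
      unfolding w(3) by (simp add: scale_right_distrib ac_simps)
    with memI[OF subspace_add[OF W subspace_scale[OF W w(1)] w(2)]] show "t \<in> k (c *s x)" by metis
  next
    fix t assume "t \<in> k (c *s x)"
    then obtain w where w: "w \<in> W" "t = c *s x + w" using memE by blast
    then have "t = c *s (x + 0) + w" by simp
    with memI[OF W0] w(1) show "t \<in> c \<odot>\<^bsub>?Q\<^esub> k x"
      unfolding smult_iff by blast
  qed
  have carE: "\<exists>x\<in>Z. X = k x" if "X \<in> carrier ?Q" for X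
    using that unfolding car by blast
  have carI: "k x \<in> carrier ?Q" if "x \<in> Z" for x
    using that unfolding car by blast
  have ab: "abelian_group ?Q"
  proof (rule abelian_groupI)
    show "\<zero>\<^bsub>?Q\<^esub> \<in> carrier ?Q"
      unfolding zero using Z0 by (rule carI)
  next
    fix X assume "X \<in> carrier ?Q"
    from carE[OF this] obtain x where x: "x \<in> Z" "X = k x" by blast
    show "\<zero>\<^bsub>?Q\<^esub> \<oplus>\<^bsub>?Q\<^esub> X = X"
      unfolding zero x(2) add by simp
    show "\<exists>Y\<in>carrier ?Q. Y \<oplus>\<^bsub>?Q\<^esub> X = \<zero>\<^bsub>?Q\<^esub>"
      using carI[OF subspace_neg[OF Z x(1)]]
      by (rule rev_bexI) (simp add: zero x(2) add)
    fix Y assume "Y \<in> carrier ?Q"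
    from carE[OF this] obtain y where y: "y \<in> Z" "Y = k y" by blast
    show "X \<oplus>\<^bsub>?Q\<^esub> Y \<in> carrier ?Q"
      unfolding x(2) y(2) add using subspace_add[OF Z x(1) y(1)] by (rule carI)
    show "X \<oplus>\<^bsub>?Q\<^esub> Y = Y \<oplus>\<^bsub>?Q\<^esub> X"
      unfolding x(2) y(2) add by (simp add: add.commute)
    fix T assume "T \<in> carrier ?Q"
    from carE[OF this] obtain t where t: "t \<in> Z" "T = k t" by blast
    show "X \<oplus>\<^bsub>?Q\<^esub> Y \<oplus>\<^bsub>?Q\<^esub> T = X \<oplus>\<^bsub>?Q\<^esub> (Y \<oplus>\<^bsub>?Q\<^esub> T)"
      unfolding x(2) y(2) t(2) add by (simp add: add.assoc)
  qed
  have mod: "Module.module (class_ring :: 'a ring) ?Q"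
  proof (intro Module.module.intro Module.module_axioms.intro ab
      domain.axioms(1)[OF Ring.field.axioms(1)[OF class_field]])
    fix c :: 'a and X assume "X \<in> carrier ?Q"
    from carE[OF this] obtain x where x: "x \<in> Z" "X = k x" by blast
    show "c \<odot>\<^bsub>?Q\<^esub> X \<in> carrier ?Q"
      unfolding x(2) smult using subspace_scale[OF Z x(1)] by (rule carI)
    show "\<one>\<^bsub>class_ring :: 'a ring\<^esub> \<odot>\<^bsub>?Q\<^esub> X = X"
      unfolding x(2) by (simp add: smult)
    fix d :: 'a
    show "(c \<oplus>\<^bsub>class_ring\<^esub> d) \<odot>\<^bsub>?Q\<^esub> X = c \<odot>\<^bsub>?Q\<^esub> X \<oplus>\<^bsub>?Q\<^esub> d \<odot>\<^bsub>?Q\<^esub> X"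
      unfolding x(2) by (simp add: smult add scale_left_distrib)
    show "(c \<otimes>\<^bsub>class_ring\<^esub> d) \<odot>\<^bsub>?Q\<^esub> X = c \<odot>\<^bsub>?Q\<^esub> (d \<odot>\<^bsub>?Q\<^esub> X)"
      unfolding x(2) by (simp add: smult)
    fix Y assume "Y \<in> carrier ?Q"
    from carE[OF this] obtain y where y: "y \<in> Z" "Y = k y" by blast
    show "c \<odot>\<^bsub>?Q\<^esub> (X \<oplus>\<^bsub>?Q\<^esub> Y) = c \<odot>\<^bsub>?Q\<^esub> X \<oplus>\<^bsub>?Q\<^esub> c \<odot>\<^bsub>?Q\<^esub> Y"
      unfolding x(2) y(2) by (simp add: smult add scale_right_distrib)
  qed
  show ?thesis
    by (intro vectorspace.intro mod class_field)
qed


section \<open>Graded vector spaces and graded-commutative algebras\<close>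

text \<open>
  A graded vector space is the external direct sum of the family \<open>B i\<close> of subspaces of
  an ambient vector space; these subspaces are not required to be independent in it.
  Connectedness, \<open>B 0 = k\<close>, is the choice of a nonzero vector \<open>u\<close> spanning \<open>B 0\<close>; the scalar \<open>c\<close> is
  identified with \<open>c \<cdot> u\<close>, so that \<open>u\<close> is the unit of every algebra on \<open>B\<close>.
\<close>

locale connected_graded_space = vector_space scl
  for scl :: "'k::field \<Rightarrow> 'v::ab_group_add \<Rightarrow> 'v" +
  fixes B :: "nat \<Rightarrow> 'v set" and u :: 'v
  assumes subspace_B: "subspace (B i)"
    and finite_dim_B: "\<exists>S. finite S \<and> B i = span S"
    and finite_support_B: "finite {i. B i \<noteq> {0}}"
    and u_nonzero: "u \<noteq> 0"
    and B_0: "B 0 = span {u}"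

definition bilinear_on ::
  "('k::field \<Rightarrow> 'v::ab_group_add \<Rightarrow> 'v) \<Rightarrow> 'v set \<Rightarrow> 'v set \<Rightarrow> 'v set \<Rightarrow> ('v \<Rightarrow> 'v \<Rightarrow> 'v) \<Rightarrow> bool" where
  "bilinear_on scl X Y Z f \<longleftrightarrow>
     (\<forall>x\<in>X. \<forall>y\<in>Y. f x y \<in> Z) \<and>
     (\<forall>x\<in>X. \<forall>x'\<in>X. \<forall>y\<in>Y. f (x + x') y = f x y + f x' y) \<and>
     (\<forall>x\<in>X. \<forall>y\<in>Y. \<forall>y'\<in>Y. f x (y + y') = f x y + f x y') \<and>
     (\<forall>c. \<forall>x\<in>X. \<forall>y\<in>Y. f (scl c x) y = scl c (f x y) \<and> f x (scl c y) = scl c (f x y))"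

type_synonym 'v mult_family = "nat \<Rightarrow> nat \<Rightarrow> 'v \<Rightarrow> 'v \<Rightarrow> 'v"

text \<open>\<open>m i j\<close> is the product \<open>B i \<times> B j \<rightarrow> B (i + j)\<close>.\<close>

definition cga ::
  "('k::field \<Rightarrow> 'v::ab_group_add \<Rightarrow> 'v) \<Rightarrow> (nat \<Rightarrow> 'v set) \<Rightarrow> 'v \<Rightarrow> 'v mult_family \<Rightarrow> bool" where
  "cga scl B u m \<longleftrightarrow>
     (\<forall>i j. bilinear_on scl (B i) (B j) (B (i + j)) (m i j)) \<and>
     (\<forall>i. \<forall>x\<in>B i. m 0 i u x = x \<and> m i 0 x u = x) \<and>
     (\<forall>i j l. \<forall>x\<in>B i. \<forall>y\<in>B j. \<forall>z\<in>B l.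
        m (i + j) l (m i j x y) z = m i (j + l) x (m j l y z)) \<and>
     (\<forall>i j. \<forall>x\<in>B i. \<forall>y\<in>B j. m i j x y = scl ((- 1) ^ (i * j)) (m j i y x))"


section \<open>The parameter space\<close>

text \<open>
  \<open>V_B\<close> is the space of families of bilinear maps \<open>B i \<times> B j \<rightarrow> B (i + j)\<close> for \<open>i, j \<ge> 1\<close>. Such
  families are made extensional by the value 0 off their domain; addition and scaling are pointwise.
\<close>

definition mult_space ::
  "('k::field \<Rightarrow> 'v::ab_group_add \<Rightarrow> 'v) \<Rightarrow> (nat \<Rightarrow> 'v set) \<Rightarrow> 'v mult_family set" where
  "mult_space scl B =
     {\<mu>. (\<forall>i\<ge>1. \<forall>j\<ge>1. bilinear_on scl (B i) (B j) (B (i + j)) (\<mu> i j)) \<and>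
         (\<forall>i j x y. \<not> (i \<ge> 1 \<and> j \<ge> 1 \<and> x \<in> B i \<and> y \<in> B j) \<longrightarrow> \<mu> i j x y = 0)}"

definition mult_scale ::
  "('k::field \<Rightarrow> 'v::ab_group_add \<Rightarrow> 'v) \<Rightarrow> 'k \<Rightarrow> 'v mult_family \<Rightarrow> 'v mult_family" where
  "mult_scale scl c \<mu> = (\<lambda>i j x y. scl c (\<mu> i j x y))"

text \<open>The multiplication in all degrees: elements \<open>c \<cdot> u\<close> of degree 0 act as the scalar \<open>c\<close>.\<close>

definition full_mult ::
  "('k::field \<Rightarrow> 'v::ab_group_add \<Rightarrow> 'v) \<Rightarrow> 'v \<Rightarrow> 'v mult_family \<Rightarrow> 'v mult_family" where
  "full_mult scl u \<mu> i j x y =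
     (if i = 0 then scl (THE c. x = scl c u) y
      else if j = 0 then scl (THE c. y = scl c u) x
      else \<mu> i j x y)"

definition cga_space ::
  "('k::field \<Rightarrow> 'v::ab_group_add \<Rightarrow> 'v) \<Rightarrow> (nat \<Rightarrow> 'v set) \<Rightarrow> 'v \<Rightarrow> 'v mult_family set" where
  "cga_space scl B u = {\<mu> \<in> mult_space scl B. cga scl B u (full_mult scl u \<mu>)}"

lemma (in vector_space) vector_space_mult_scale: "vector_space (mult_scale scale)"
  by unfold_locales
    (simp_all add: mult_scale_def fun_eq_iff scale_right_distrib scale_left_distrib)

text \<open>Every algebra structure on \<open>B\<close> with unit \<open>u\<close> is given by exactly one point of \<open>cga_space\<close>.\<close>

lemma (in connected_graded_space) ex1_cga_space:
  fixes m :: "'v mult_family"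
  assumes m: "cga scl B u m"
  shows "\<exists>!\<mu>. \<mu> \<in> cga_space scl B u \<and>
           (\<forall>i j. \<forall>x\<in>B i. \<forall>y\<in>B j. full_mult scl u \<mu> i j x y = m i j x y)"
proof -
  define \<mu> where "\<mu> = (\<lambda>i j x y. if i \<ge> 1 \<and> j \<ge> 1 \<and> x \<in> B i \<and> y \<in> B j then m i j x y else 0)"
  have the: "(THE d. scl c u = scl d u) = c" for c
    using u_nonzero by (intro the_equality) auto
  have B0: "\<exists>c. x = scl c u" if "x \<in> B 0" for x
    using that unfolding B_0 span_singleton by auto
  have uB: "u \<in> B 0"
    unfolding B_0 by (simp add: span_base)
  have bil: "bilinear_on scl (B i) (B j) (B (i + j)) (m i j)" for i j
    using m by (simp add: cga_def)
  have full: "full_mult scl u \<mu> i j x y = m i j x y" if x: "x \<in> B i" and y: "y \<in> B j" for i j x y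
  proof (cases "i = 0 \<or> j = 0")
    case False
    then show ?thesis using x y by (simp add: full_mult_def \<mu>_def)
  next
    case True
    have "full_mult scl u \<mu> i j x y = m i j x y" if i: "i = 0"
    proof -
      obtain c where c: "x = scl c u" using B0 x i by blast
      have "m 0 j x y = scl c (m 0 j u y)"
        using bil[of 0 j] uB y unfolding c bilinear_on_def by blast
      then show ?thesis
        using m y unfolding i cga_def full_mult_def c the by simp
    qed
    moreover have "full_mult scl u \<mu> i j x y = m i j x y" if j: "j = 0" and i: "i \<noteq> 0"
    proof -
      obtain c where c: "y = scl c u" using B0 y j by blast
      have "m i 0 x y = scl c (m i 0 x u)"
        using bil[of i 0] uB x unfolding c bilinear_on_def by blast
      then show ?thesis
        using m x i unfolding j cga_def full_mult_def c the by simp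
    qed
    ultimately show ?thesis using True by blast
  qed
  have "bilinear_on scl (B i) (B j) (B (i + j)) (\<mu> i j)" if "i \<ge> 1" "j \<ge> 1" for i j
    using bil[of i j] that subspace_add[OF subspace_B] subspace_scale[OF subspace_B]
    unfolding bilinear_on_def by (simp add: \<mu>_def)
  then have V: "\<mu> \<in> mult_space scl B"
    unfolding mult_space_def by (simp add: \<mu>_def)
  have closed: "m i j x y \<in> B (i + j)" if "x \<in> B i" "y \<in> B j" for i j x y
    using bil[of i j] that by (simp add: bilinear_on_def)
  have "cga scl B u (full_mult scl u \<mu>)"
    unfolding cga_def
  proof (intro conjI allI ballI)
    fix i j
    show "bilinear_on scl (B i) (B j) (B (i + j)) (full_mult scl u \<mu> i j)"
      using bil[of i j] subspace_add[OF subspace_B] subspace_scale[OF subspace_B]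
      unfolding bilinear_on_def by (simp add: full)
  next
    fix i x assume "x \<in> B i"
    with m show "full_mult scl u \<mu> 0 i u x = x" "full_mult scl u \<mu> i 0 x u = x"
      unfolding full[OF uB \<open>x \<in> B i\<close>] full[OF \<open>x \<in> B i\<close> uB] cga_def by blast+
  next
    fix i j l x y z assume x: "x \<in> B i" and y: "y \<in> B j" and z: "z \<in> B l"
    with m show "full_mult scl u \<mu> (i + j) l (full_mult scl u \<mu> i j x y) z =
        full_mult scl u \<mu> i (j + l) x (full_mult scl u \<mu> j l y z)"
      unfolding full[OF x y] full[OF y z] full[OF x closed[OF y z]] full[OF closed[OF x y] z]
        cga_def by blast
  next
    fix i j x y assume x: "x \<in> B i" and y: "y \<in> B j"
    with m show "full_mult scl u \<mu> i j x y = scl ((- 1) ^ (i * j)) (full_mult scl u \<mu> j i y x)"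
      unfolding full[OF x y] full[OF y x] cga_def by blast
  qed
  with V have "\<mu> \<in> cga_space scl B u"
    by (simp add: cga_space_def)
  moreover have "\<nu> = \<mu>" if "\<nu> \<in> mult_space scl B"
    "\<forall>i j. \<forall>x\<in>B i. \<forall>y\<in>B j. full_mult scl u \<nu> i j x y = m i j x y" for \<nu>
  proof (intro ext)
    fix i j x y
    show "\<nu> i j x y = \<mu> i j x y"
    proof (cases "i \<ge> 1 \<and> j \<ge> 1 \<and> x \<in> B i \<and> y \<in> B j")
      case True
      then have "full_mult scl u \<nu> i j x y = m i j x y" using that(2) by blast
      then show ?thesis using True by (simp add: full_mult_def \<mu>_def)
    next
      case False
      then show ?thesis using that(1) unfolding mult_space_def \<mu>_def by auto
    qed
  qed
  ultimately show ?thesis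
    by (intro ex1I[of _ \<mu>]) (simp_all add: full cga_space_def)
qed

definition cga_space_topology ::
  "('k::field \<Rightarrow> 'v::ab_group_add \<Rightarrow> 'v) \<Rightarrow> (nat \<Rightarrow> 'v set) \<Rightarrow> 'v \<Rightarrow> 'v mult_family topology" where
  "cga_space_topology scl B u =
     subtopology (zariski (mult_scale scl) (mult_space scl B)) (cga_space scl B u)"


section \<open>Resonance varieties\<close>

definition cocycles :: "(nat \<Rightarrow> 'v::ab_group_add set) \<Rightarrow> 'v mult_family \<Rightarrow> 'v \<Rightarrow> nat \<Rightarrow> 'v set" where
  "cocycles B m a i = {b \<in> B i. m 1 i a b = 0}"

definition coboundaries :: "(nat \<Rightarrow> 'v::ab_group_add set) \<Rightarrow> 'v mult_family \<Rightarrow> 'v \<Rightarrow> nat \<Rightarrow> 'v set" where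
  "coboundaries B m a i = (if i = 0 then {0} else m 1 (i - 1) a ` B (i - 1))"

definition cohomology ::
  "('k::field \<Rightarrow> 'v::ab_group_add \<Rightarrow> 'v) \<Rightarrow> (nat \<Rightarrow> 'v set) \<Rightarrow> 'v mult_family \<Rightarrow> 'v \<Rightarrow> nat \<Rightarrow>
    ('k, 'v set) module" where
  "cohomology scl B m a i = quotient_space scl (cocycles B m a i) (coboundaries B m a i)"

definition resonance ::
  "('k::field \<Rightarrow> 'v::ab_group_add \<Rightarrow> 'v) \<Rightarrow> (nat \<Rightarrow> 'v set) \<Rightarrow> 'v mult_family \<Rightarrow> nat \<Rightarrow> nat \<Rightarrow> 'v set"
  where
  "resonance scl B m i d =
     {a \<in> B 1. m 1 1 a a = 0 \<and>
        d \<le> vectorspace.dim (class_ring :: 'k ring) (cohomology scl B m a i)}"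

definition trivial_resonance ::
  "('k::field \<Rightarrow> 'v::ab_group_add \<Rightarrow> 'v) \<Rightarrow> (nat \<Rightarrow> 'v set) \<Rightarrow> 'v \<Rightarrow> nat \<Rightarrow> 'v mult_family set" where
  "trivial_resonance scl B u i =
     {\<mu> \<in> cga_space scl B u. resonance scl B (full_mult scl u \<mu>) i 1 \<subseteq> {0}}"

end

theory Submission
  imports Defs "Jordan_Normal_Form.Determinant"
begin

text \<open>
  Near an algebra with \<open>a\<^sup>2 = 0\<close> and \<open>H\<^sup>i(A, \<delta>(a)) = 0\<close> a contracting homotopy \<open>(h, k)\<close> of
  \<open>B\<^bsup>i-1\<^esup> \<rightarrow> B\<^sup>i \<rightarrow> B\<^bsup>i+1\<^esup>\<close> can be kept fixed: as long as \<open>det (\<delta> h + k \<delta>) \<noteq> 0\<close> on \<open>B\<^sup>i\<close>, the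
  cohomology stays zero. Hence the pairs \<open>(A, a)\<close> with \<open>a\<close> in the resonance variety form a closed cone
  over \<open>P\<^sub>B\<close>, and the theorem is the completeness of projective space. The latter is proved by
  eliminating one coordinate of \<open>a\<close> at a time: if the coordinate axis \<open>e\<close> over the base point is not in
  the cone, some homogeneous equation is nonzero there, its leading coefficient in that coordinate is
  a function \<open>h\<close> of \<open>A\<close> alone, and over \<open>h \<noteq> 0\<close> the projection along \<open>e\<close> is closed by resultants.
\<close>

section \<open>Common roots of two polynomials\<close>

text \<open>If the field were finite, one plus the product of all its monic linear factors would
  have positive degree but no root. Infinitude is used twice below: to separate homogeneous
  components on a cone, and to choose a scalar outside a finite set.\<close>

lemma infinite_UNIV_alg_closed: "infinite (UNIV :: 'k::alg_closed_field set)"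
proof
  assume fin: "finite (UNIV :: 'k set)"
  define p where "p = (\<Prod>a\<in>(UNIV :: 'k set). [:- a, 1:]) + 1"
  have val: "poly p x = 1" for x
  proof -
    have "(\<Prod>a\<in>UNIV. poly [:- a, 1:] x) = 0"
      using fin by (auto intro!: prod_zero bexI[of _ x])
    then show ?thesis by (simp add: p_def poly_prod)
  qed
  have "degree (\<Prod>a\<in>(UNIV :: 'k set). [:- a, 1:]) = card (UNIV :: 'k set)"
    by (subst degree_prod_sum_eq) auto
  moreover have "card (UNIV :: 'k set) > 0"
    using fin by (simp add: card_gt_0_iff)
  ultimately have "degree p > 0"
    unfolding p_def by (subst degree_add_eq_left) auto
  then obtain x where "poly p x = 0"
    using alg_closed_imp_poly_has_root by blast
  with val show False by simp
qed

lemma poly_eq_sum_le: "degree p \<le> m \<Longrightarrow> poly p x = (\<Sum>k\<le>m. coeff p k * x ^ k)"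
  for x :: "'a::comm_ring_1"
  by (subst poly_as_sum_of_monoms'[of p m, symmetric]) (simp_all add: poly_sum poly_monom)

text \<open>Euclid's lemma with coprimality expressed by roots. A root t of p is not a root of q,
  hence is one of b; the factor X - t cancels on both sides and the degree of p drops.\<close>

lemma dvd_of_dvd_mult_if_no_common_root:
  fixes p q b :: "'k::alg_closed_field poly"
  assumes "p dvd b * q" and "\<And>t. poly p t = 0 \<Longrightarrow> poly q t \<noteq> 0" and "p \<noteq> 0"
  shows "p dvd b"
  using assms
proof (induction "degree p" arbitrary: p b)
  case 0
  then have "p dvd 1" by (metis is_unit_iff_degree)
  then show ?case by (rule unit_imp_dvd)
next
  case (Suc n)
  then obtain t where t: "poly p t = 0"
    using alg_closed_imp_poly_has_root[of p] by auto
  then obtain p' where p': "p = [:- t, 1:] * p'"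
    by (auto simp: poly_eq_0_iff_dvd elim: dvdE)
  have "[:- t, 1:] dvd b * q"
    using Suc.prems(1) unfolding p' by (rule dvd_mult_left)
  then have "poly b t = 0"
    using Suc.prems(2)[OF t] by (auto simp: poly_eq_0_iff_dvd[symmetric])
  then obtain b' where b': "b = [:- t, 1:] * b'"
    by (auto simp: poly_eq_0_iff_dvd elim: dvdE)
  have ne: "p' \<noteq> 0" using Suc.prems(3) p' by auto
  have "[:- t, 1:] * p' dvd [:- t, 1:] * (b' * q)"
    using Suc.prems(1) unfolding p' b' by (simp only: mult.assoc)
  then have "p' dvd b' * q"
    by (subst (asm) dvd_mult_cancel_left) auto
  moreover have "n = degree p'"
    using Suc.hyps(2) ne unfolding p' by (subst (asm) degree_mult_eq) auto
  moreover have "poly q s \<noteq> 0" if "poly p' s = 0" for s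
    using Suc.prems(2)[of s] that unfolding p' by simp
  ultimately have "p' dvd b'"
    using Suc.hyps(1)[of p' b'] ne by blast
  then show ?case unfolding p' b' by (rule mult_dvd_mono[OF dvd_refl])
qed

text \<open>The rows are the coefficients of X^i p for i < n, followed by those of X^i q for i < m,
  so the determinant is the resultant up to sign. The nominal degrees m and n are parameters so that
  the size stays fixed while p and q vary in a family.\<close>

definition sylvester :: "nat \<Rightarrow> nat \<Rightarrow> 'k::field poly \<Rightarrow> 'k poly \<Rightarrow> 'k mat" where
  "sylvester m n p q =
     mat (m + n) (m + n) (\<lambda>(i, j). coeff (monom 1 (if i < n then i else i - n) * (if i < n then p else q)) j)"

lemma sylvester_carrier [simp]: "sylvester m n p q \<in> carrier_mat (m + n) (m + n)"
  by (simp add: sylvester_def)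

text \<open>A common root t yields the kernel vector (1, t, t^2, ...): each row pairs with it to the
  value at t of a multiple of p or of q.\<close>

lemma det_sylvester_eq_0:
  assumes "degree p \<le> m" "degree q \<le> n" "p \<noteq> 0" and t: "poly p t = 0" "poly q t = 0"
  shows "det (sylvester m n p q) = 0"
proof -
  \<comment> \<open>This rules out the empty matrix, whose determinant is 1, and guarantees that the
    kernel vector has its entry 1 at index 0.\<close>
  have m: "m > 0"
  proof (rule ccontr)
    assume "\<not> m > 0"
    with assms(1) have "degree p = 0" by simp
    with t(1) \<open>p \<noteq> 0\<close> show False
      by (metis degree_eq_zeroE pCons_0_0 mult_zero_right poly_0 poly_pCons add.right_neutral)
  qed
  define v where "v = vec (m + n) (\<lambda>j. t ^ j)"
  have "v $ 0 = 1" using m by (simp add: v_def)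
  then have "v \<noteq> 0\<^sub>v (m + n)" using m by fastforce
  then have v: "v \<in> carrier_vec (m + n)" "v \<noteq> 0\<^sub>v (m + n)"
    by (simp_all add: v_def)
  have "sylvester m n p q *\<^sub>v v = 0\<^sub>v (m + n)"
  proof (intro eq_vecI)
    fix i assume "i < dim_vec (0\<^sub>v (m + n) :: 'a vec)"
    then have i: "i < m + n" by simp
    define r where "r = monom 1 (if i < n then i else i - n) * (if i < n then p else q)"
    have "degree r \<le> (if i < n then i else i - n) + (if i < n then m else n)"
      unfolding r_def using assms(1,2)
      by (intro order.trans[OF degree_mult_le] add_mono) (auto simp: degree_monom_eq)
    with i have "degree r \<le> m + n - 1" by (auto split: if_splits)
    then have "poly r t = (\<Sum>j\<le>m + n - 1. coeff r j * t ^ j)"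
      by (rule poly_eq_sum_le)
    also have "{..m + n - 1} = {0..<m + n}" using m by auto
    finally have "(\<Sum>j = 0..<m + n. coeff r j * t ^ j) = poly r t" ..
    also have "poly r t = 0" using t by (simp add: r_def)
    finally show "(sylvester m n p q *\<^sub>v v) $ i = 0\<^sub>v (m + n) $ i"
      using i by (simp add: sylvester_def v_def scalar_prod_def r_def)
  qed (simp add: sylvester_def)
  with v show ?thesis
    using det_0_iff_vec_prod_zero_field[OF sylvester_carrier] by blast
qed

text \<open>In a relation a p + b q = 0 the absence of common roots makes p divide b, and deg b < m
  = deg p then forces b = 0 and a = 0. Only p has to attain its nominal degree; q may fall short of
  n.\<close>

lemma det_sylvester_neq_0:
  fixes p q :: "'k::alg_closed_field poly"
  assumes "degree p = m" "degree q \<le> n" "p \<noteq> 0"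
    and no_root: "\<And>t. poly p t = 0 \<Longrightarrow> poly q t \<noteq> 0"
  shows "det (sylvester m n p q) \<noteq> 0"
proof
  let ?S = "sylvester m n p q"
  assume "det ?S = 0"
  then have "det (transpose_mat ?S) = 0"
    using det_transpose[OF sylvester_carrier] by metis
  then obtain v where v: "v \<in> carrier_vec (m + n)" "v \<noteq> 0\<^sub>v (m + n)"
      "transpose_mat ?S *\<^sub>v v = 0\<^sub>v (m + n)"
    using det_0_iff_vec_prod_zero_field[of "transpose_mat ?S" "m + n"] by auto
  text \<open>An element of the left kernel is a relation \<open>a p + b q = 0\<close> with \<open>deg a < n\<close>, \<open>deg b < m\<close>.\<close>
  define a where "a = (\<Sum>i<n. monom (v $ i) i)"
  define b where "b = (\<Sum>i<m. monom (v $ (n + i)) i)"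
  have ca: "coeff a i = v $ i" if "i < n" for i
    using that by (simp add: a_def coeff_sum sum.delta)
  have cb: "coeff b i = v $ (n + i)" if "i < m" for i
    using that by (simp add: b_def coeff_sum sum.delta)
  have cb': "coeff b i = 0" if "i \<ge> m" for i
    using that by (simp add: b_def coeff_sum)
  have split: "(\<Sum>i=0..<m + n. f i) = (\<Sum>i<n. f i) + (\<Sum>i<m. f (n + i))" for f :: "nat \<Rightarrow> 'k"
  proof -
    have "{0..<m + n} = {..<n} \<union> (+) n ` {..<m}"
      using image_add_atLeastLessThan[of n 0 m] by (auto simp: lessThan_atLeast0)
    then show ?thesis
      by (simp only:) (subst sum.union_disjoint, auto simp: sum.reindex)
  qed
  have "coeff (a * p + b * q) j = 0" for j
  proof -
    have eq: "coeff (a * p + b * q) j =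
        (\<Sum>i<n. coeff (monom 1 i * p) j * v $ i) + (\<Sum>i<m. coeff (monom 1 i * q) j * v $ (n + i))"
    proof -
      have mono: "coeff (monom c i * r) j = coeff (monom 1 i * r) j * c" for c :: 'k and i and r
        by (simp add: coeff_monom_mult)
      show ?thesis
        by (simp add: a_def b_def sum_distrib_right coeff_sum mono[of "v $ _"])
    qed
    show ?thesis
    proof (cases "j < m + n")
      case True
      have "coeff (a * p + b * q) j = (transpose_mat ?S *\<^sub>v v) $ j"
        using True v(1) unfolding eq by (simp add: sylvester_def scalar_prod_def split)
      then show ?thesis using v(3) True by simp
    next
      case False
      then have "coeff p (j - i) = 0" if "i < n" for i
        using that assms(1) by (intro coeff_eq_0) simp
      then have "(\<Sum>i<n. coeff (monom 1 i * p) j * v $ i) = 0"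
        by (intro sum.neutral) (simp add: coeff_monom_mult)
      moreover from False have "coeff q (j - i) = 0" if "i < m" for i
        using that assms(2) by (intro coeff_eq_0) simp
      then have "(\<Sum>i<m. coeff (monom 1 i * q) j * v $ (n + i)) = 0"
        by (intro sum.neutral) (simp add: coeff_monom_mult)
      ultimately show ?thesis
        unfolding eq by simp
    qed
  qed
  then have eq: "a * p + b * q = 0" by (simp add: poly_eq_iff)
  then have "b * q = p * (- a)" by (simp add: algebra_simps add_eq_0_iff)
  then have "p dvd b * q" by (metis dvd_triv_left)
  then have "p dvd b" 
    using dvd_of_dvd_mult_if_no_common_root no_root \<open>p \<noteq> 0\<close> by blast
  have "b = 0"
  proof (rule ccontr)
    assume "b \<noteq> 0"
    then have "degree b < m" using cb' by (metis leading_coeff_0_iff not_less)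
    moreover have "degree p \<le> degree b" using \<open>p dvd b\<close> \<open>b \<noteq> 0\<close> by (rule dvd_imp_degree_le)
    ultimately show False using assms(1) by simp
  qed
  with eq \<open>p \<noteq> 0\<close> have "a = 0" by simp
  have "v = 0\<^sub>v (m + n)"
  proof (rule eq_vecI)
    fix i assume "i < dim_vec (0\<^sub>v (m + n) :: 'k vec)"
    then have "i < m + n" by simp
    then show "v $ i = 0\<^sub>v (m + n) $ i"
      using ca[of i] cb[of "i - n"] \<open>a = 0\<close> \<open>b = 0\<close> by (cases "i < n") auto
  qed (use v in simp)
  with v(2) show False by blast
qed

section \<open>Polynomial functions in finitely many variables\<close>

locale function_algebra =
  fixes R :: "('x \<Rightarrow> 'k::comm_ring_1) set"
  assumes const_mem: "(\<lambda>_. c) \<in> R"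
    and add_mem: "f \<in> R \<Longrightarrow> g \<in> R \<Longrightarrow> (\<lambda>\<mu>. f \<mu> + g \<mu>) \<in> R"
    and mult_mem: "f \<in> R \<Longrightarrow> g \<in> R \<Longrightarrow> (\<lambda>\<mu>. f \<mu> * g \<mu>) \<in> R"
begin

text \<open>These are functions on base times affine n-space, generated by rules instead of being
  written in a normal form: closure properties are immediate, and structural facts follow by rule
  induction.\<close>

inductive polyfun :: "nat \<Rightarrow> ('x \<Rightarrow> (nat \<Rightarrow> 'k) \<Rightarrow> 'k) \<Rightarrow> bool" for n where
  coef: "f \<in> R \<Longrightarrow> polyfun n (\<lambda>\<mu> _. f \<mu>)"
| var: "j < n \<Longrightarrow> polyfun n (\<lambda>_ x. x j)"
| add: "polyfun n F \<Longrightarrow> polyfun n G \<Longrightarrow> polyfun n (\<lambda>\<mu> x. F \<mu> x + G \<mu> x)"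
| mult: "polyfun n F \<Longrightarrow> polyfun n G \<Longrightarrow> polyfun n (\<lambda>\<mu> x. F \<mu> x * G \<mu> x)"

text \<open>The degree counts only the coordinates x; functions of the base point have degree 0. The
  rule \<open>zero\<close> gives the zero function every degree, so that absent components of a
  polynomial still count as homogeneous.\<close>

inductive homog :: "nat \<Rightarrow> nat \<Rightarrow> ('x \<Rightarrow> (nat \<Rightarrow> 'k) \<Rightarrow> 'k) \<Rightarrow> bool" for n where
  zero: "homog n d (\<lambda>_ _. 0)"
| coef: "f \<in> R \<Longrightarrow> homog n 0 (\<lambda>\<mu> _. f \<mu>)"
| var: "j < n \<Longrightarrow> homog n 1 (\<lambda>_ x. x j)"
| add: "homog n d F \<Longrightarrow> homog n d G \<Longrightarrow> homog n d (\<lambda>\<mu> x. F \<mu> x + G \<mu> x)"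
| mult: "homog n d F \<Longrightarrow> homog n e G \<Longrightarrow> homog n (d + e) (\<lambda>\<mu> x. F \<mu> x * G \<mu> x)"

section \<open>Closure properties and decompositions of polynomial functions\<close>

lemma polyfun_const: "polyfun n (\<lambda>_ _. c)"
  by (rule polyfun.coef[OF const_mem])

lemma polyfun_sum:
  assumes "\<And>a. a \<in> A \<Longrightarrow> polyfun n (F a)"
  shows "polyfun n (\<lambda>\<mu> x. \<Sum>a\<in>A. F a \<mu> x)"
  using assms by (induction A rule: infinite_finite_induct) (auto intro: polyfun_const polyfun.add)

lemma polyfun_prod:
  assumes "\<And>a. a \<in> A \<Longrightarrow> polyfun n (F a)"
  shows "polyfun n (\<lambda>\<mu> x. \<Prod>a\<in>A. F a \<mu> x)"
  using assms by (induction A rule: infinite_finite_induct) (auto intro: polyfun_const polyfun.mult)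

lemma polyfun_det:
  assumes "\<And>\<mu> x. M \<mu> x \<in> carrier_mat N N"
    and "\<And>i j. i < N \<Longrightarrow> j < N \<Longrightarrow> polyfun n (\<lambda>\<mu> x. M \<mu> x $$ (i, j))"
  shows "polyfun n (\<lambda>\<mu> x. det (M \<mu> x))"
  unfolding det_def'[OF assms(1)]
  by (intro polyfun_sum polyfun.mult polyfun_const polyfun_prod assms(2))
    (auto dest: permutes_in_image)

lemma polyfun_cong: "polyfun n F \<Longrightarrow> (\<And>j. j < n \<Longrightarrow> x j = y j) \<Longrightarrow> F \<mu> x = F \<mu> y"
  by (induction rule: polyfun.induct) auto

lemma homog_imp_polyfun: "homog n d F \<Longrightarrow> polyfun n F"
  by (induction rule: homog.induct) (auto intro: polyfun_const polyfun.intros)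

lemma homog_scale: "homog n d F \<Longrightarrow> F \<mu> (\<lambda>j. c * x j) = c ^ d * F \<mu> x"
  by (induction rule: homog.induct) (auto simp: algebra_simps power_add)

lemma homog_sum:
  assumes "\<And>a. a \<in> A \<Longrightarrow> homog n d (F a)"
  shows "homog n d (\<lambda>\<mu> x. \<Sum>a\<in>A. F a \<mu> x)"
  using assms by (induction A rule: infinite_finite_induct) (auto intro: homog.zero homog.add)

text \<open>Used to see that the leading coefficient of a homogeneous equation in the last
  coordinate depends on the base point alone.\<close>

lemma homog_0_imp_coef: "homog n d F \<Longrightarrow> d = 0 \<Longrightarrow> \<exists>f\<in>R. F = (\<lambda>\<mu> _. f \<mu>)"
proof (induction rule: homog.induct)
  case (zero d)
  show ?case using const_mem[of 0] by (intro bexI[of _ "\<lambda>_. 0"]) simp_all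
next
  case (add d F G)
  then obtain f g where "f \<in> R" "F = (\<lambda>\<mu> _. f \<mu>)" "g \<in> R" "G = (\<lambda>\<mu> _. g \<mu>)" by blast
  then show ?case using add_mem[of f g] by (intro bexI[of _ "\<lambda>\<mu>. f \<mu> + g \<mu>"]) simp_all
next
  case (mult d F e G)
  then obtain f g where "f \<in> R" "F = (\<lambda>\<mu> _. f \<mu>)" "g \<in> R" "G = (\<lambda>\<mu> _. g \<mu>)" by auto
  then show ?case using mult_mem[of f g] by (intro bexI[of _ "\<lambda>\<mu>. f \<mu> * g \<mu>"]) simp_all
next
  case (coef f)
  then show ?case by (intro bexI[of _ f]) simp_all
qed simp

text \<open>The variable of \<open>p \<mu> x\<close> is a formal marker of degree: its k-th
  coefficient is a component of F of degree k, and setting the marker to 1 adds the components up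
  again.\<close>

lemma polyfun_decompose:
  assumes "polyfun n F"
  shows "\<exists>p m. (\<forall>k. homog n k (\<lambda>\<mu> x. coeff (p \<mu> x) k)) \<and>
           (\<forall>\<mu> x. degree (p \<mu> x) \<le> m) \<and> (\<forall>\<mu> x. poly (p \<mu> x) 1 = F \<mu> x)"
  using assms
proof (induction rule: polyfun.induct)
  case (coef f)
  have "homog n k (\<lambda>\<mu> x. coeff [:f \<mu>:] k)" for k
    using coef by (cases k) (auto intro: homog.intros)
  then show ?case
    by (intro exI[of _ "\<lambda>\<mu> x. [:f \<mu>:]"] exI[of _ 0]) simp
next
  case (var j)
  have "homog n k (\<lambda>\<mu> x. coeff (monom (x j) 1) k)" for k
    using var homog.var[of j n] by (cases "k = 1") (auto intro: homog.zero)
  then show ?case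
    by (intro exI[of _ "\<lambda>\<mu> x. monom (x j) 1"] exI[of _ 1]) (simp add: degree_monom_le poly_monom)
next
  case (add F G)
  then obtain p m q l where
    p: "\<forall>k. homog n k (\<lambda>\<mu> x. coeff (p \<mu> x) k)" "\<forall>\<mu> x. degree (p \<mu> x) \<le> m" "\<forall>\<mu> x. poly (p \<mu> x) 1 = F \<mu> x" and
    q: "\<forall>k. homog n k (\<lambda>\<mu> x. coeff (q \<mu> x) k)" "\<forall>\<mu> x. degree (q \<mu> x) \<le> l" "\<forall>\<mu> x. poly (q \<mu> x) 1 = G \<mu> x"
    by blast
  have "degree (p \<mu> x + q \<mu> x) \<le> m + l" for \<mu> x
    using p(2) q(2) by (intro degree_add_le) (simp_all add: trans_le_add1 trans_le_add2)
  then show ?case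
    by (intro exI[of _ "\<lambda>\<mu> x. p \<mu> x + q \<mu> x"] exI[of _ "m + l"])
      (use p q in \<open>simp add: homog.add\<close>)
next
  case (mult F G)
  then obtain p m q l where
    p: "\<forall>k. homog n k (\<lambda>\<mu> x. coeff (p \<mu> x) k)" "\<forall>\<mu> x. degree (p \<mu> x) \<le> m" "\<forall>\<mu> x. poly (p \<mu> x) 1 = F \<mu> x" and
    q: "\<forall>k. homog n k (\<lambda>\<mu> x. coeff (q \<mu> x) k)" "\<forall>\<mu> x. degree (q \<mu> x) \<le> l" "\<forall>\<mu> x. poly (q \<mu> x) 1 = G \<mu> x"
    by blast
  have "homog n k (\<lambda>\<mu> x. coeff (p \<mu> x) i * coeff (q \<mu> x) (k - i))" if "i \<le> k" for i k
    using homog.mult[of n i _ "k - i"] p(1) q(1) that by simp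
  then have "homog n k (\<lambda>\<mu> x. coeff (p \<mu> x * q \<mu> x) k)" for k
    unfolding coeff_mult by (intro homog_sum) simp
  moreover have "degree (p \<mu> x * q \<mu> x) \<le> m + l" for \<mu> x
    using p(2) q(2) by (meson add_mono degree_mult_le order_trans)
  ultimately show ?case
    by (intro exI[of _ "\<lambda>\<mu> x. p \<mu> x * q \<mu> x"] exI[of _ "m + l"]) (use p q in simp)
qed

text \<open>A polynomial in n + 1 variables is a polynomial in the last one over those in the first
  n. The degree bound is uniform in \<mu> and x, which is what a Sylvester matrix of constant size
  requires.\<close>

lemma polyfun_last:
  assumes "polyfun (Suc n) F"
  shows "\<exists>p m. (\<forall>k. polyfun n (\<lambda>\<mu> x. coeff (p \<mu> x) k)) \<and>
           (\<forall>\<mu> x. degree (p \<mu> x) \<le> m) \<and> (\<forall>\<mu> x. poly (p \<mu> x) (x n) = F \<mu> x)"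
  using assms
proof (induction rule: polyfun.induct)
  case (coef f)
  have "polyfun n (\<lambda>\<mu> x. coeff [:f \<mu>:] k)" for k
    using coef by (cases k) (auto intro: polyfun.intros polyfun_const)
  then show ?case
    by (intro exI[of _ "\<lambda>\<mu> x. [:f \<mu>:]"] exI[of _ 0]) simp
next
  case (var j)
  show ?case
  proof (cases "j = n")
    case True
    have "polyfun n (\<lambda>\<mu> x. coeff [:0, 1:] k)" for k
      by (rule polyfun_const)
    with True show ?thesis
      by (intro exI[of _ "\<lambda>\<mu> x. [:0, 1:]"] exI[of _ 1]) simp
  next
    case False
    have "polyfun n (\<lambda>\<mu> x. coeff [:x j:] k)" for k
      using var False by (cases k) (auto intro: polyfun.intros polyfun_const)
    then show ?thesis
      by (intro exI[of _ "\<lambda>\<mu> x. [:x j:]"] exI[of _ 0]) simp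
  qed
next
  case (add F G)
  then obtain p m q l where
    p: "\<forall>k. polyfun n (\<lambda>\<mu> x. coeff (p \<mu> x) k)" "\<forall>\<mu> x. degree (p \<mu> x) \<le> m" "\<forall>\<mu> x. poly (p \<mu> x) (x n) = F \<mu> x" and
    q: "\<forall>k. polyfun n (\<lambda>\<mu> x. coeff (q \<mu> x) k)" "\<forall>\<mu> x. degree (q \<mu> x) \<le> l" "\<forall>\<mu> x. poly (q \<mu> x) (x n) = G \<mu> x"
    by blast
  have "degree (p \<mu> x + q \<mu> x) \<le> m + l" for \<mu> x
    using p(2) q(2) by (intro degree_add_le) (simp_all add: trans_le_add1 trans_le_add2)
  then show ?case
    by (intro exI[of _ "\<lambda>\<mu> x. p \<mu> x + q \<mu> x"] exI[of _ "m + l"])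
      (use p q in \<open>simp add: polyfun.add\<close>)
next
  case (mult F G)
  then obtain p m q l where
    p: "\<forall>k. polyfun n (\<lambda>\<mu> x. coeff (p \<mu> x) k)" "\<forall>\<mu> x. degree (p \<mu> x) \<le> m" "\<forall>\<mu> x. poly (p \<mu> x) (x n) = F \<mu> x" and
    q: "\<forall>k. polyfun n (\<lambda>\<mu> x. coeff (q \<mu> x) k)" "\<forall>\<mu> x. degree (q \<mu> x) \<le> l" "\<forall>\<mu> x. poly (q \<mu> x) (x n) = G \<mu> x"
    by blast
  have "polyfun n (\<lambda>\<mu> x. coeff (p \<mu> x * q \<mu> x) k)" for k
    unfolding coeff_mult using p(1) q(1) by (intro polyfun_sum polyfun.mult) simp_all
  moreover have "degree (p \<mu> x * q \<mu> x) \<le> m + l" for \<mu> x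
    using p(2) q(2) by (meson add_mono degree_mult_le order_trans)
  ultimately show ?case
    by (intro exI[of _ "\<lambda>\<mu> x. p \<mu> x * q \<mu> x"] exI[of _ "m + l"]) (use p q in simp)
qed

text \<open>The graded refinement of \<open>polyfun_last\<close>: a factor x_n^k leaves degree d - k
  for its coefficient, so the coefficient of x_n^d has degree 0.\<close>

lemma homog_last:
  assumes "homog (Suc n) d F"
  shows "\<exists>p. (\<forall>k\<le>d. homog n (d - k) (\<lambda>\<mu> x. coeff (p \<mu> x) k)) \<and>
           (\<forall>\<mu> x. degree (p \<mu> x) \<le> d) \<and> (\<forall>\<mu> x. poly (p \<mu> x) (x n) = F \<mu> x)"
  using assms
proof (induction rule: homog.induct)
  case (zero d)
  show ?case
    by (intro exI[of _ "\<lambda>_ _. 0"]) (simp add: homog.zero)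
next
  case (coef f)
  then show ?case
    by (intro exI[of _ "\<lambda>\<mu> x. [:f \<mu>:]"]) (simp add: homog.coef)
next
  case (var j)
  show ?case
  proof (cases "j = n")
    case True
    have "homog n (1 - k) (\<lambda>\<mu> x. coeff [:0, 1:] k)" if "k \<le> 1" for k
      using that homog.coef[OF const_mem[of 1], of n] homog.zero
      by (cases k) auto
    with True show ?thesis
      by (intro exI[of _ "\<lambda>\<mu> x. [:0, 1:]"]) simp
  next
    case False
    have "homog n (1 - k) (\<lambda>\<mu> x. coeff [:x j:] k)" if "k \<le> 1" for k
      using that var False homog.var[of j n] homog.zero by (cases k) auto
    then show ?thesis
      by (intro exI[of _ "\<lambda>\<mu> x. [:x j:]"]) simp
  qed
next
  case (add d F G)
  then obtain p q where
    p: "\<forall>k\<le>d. homog n (d - k) (\<lambda>\<mu> x. coeff (p \<mu> x) k)" "\<forall>\<mu> x. degree (p \<mu> x) \<le> d" "\<forall>\<mu> x. poly (p \<mu> x) (x n) = F \<mu> x" and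
    q: "\<forall>k\<le>d. homog n (d - k) (\<lambda>\<mu> x. coeff (q \<mu> x) k)" "\<forall>\<mu> x. degree (q \<mu> x) \<le> d" "\<forall>\<mu> x. poly (q \<mu> x) (x n) = G \<mu> x"
    by blast
  show ?case
    by (intro exI[of _ "\<lambda>\<mu> x. p \<mu> x + q \<mu> x"])
      (use p q in \<open>simp add: homog.add degree_add_le\<close>)
next
  case (mult d F e G)
  then obtain p q where
    p: "\<forall>k\<le>d. homog n (d - k) (\<lambda>\<mu> x. coeff (p \<mu> x) k)" "\<forall>\<mu> x. degree (p \<mu> x) \<le> d" "\<forall>\<mu> x. poly (p \<mu> x) (x n) = F \<mu> x" and
    q: "\<forall>k\<le>e. homog n (e - k) (\<lambda>\<mu> x. coeff (q \<mu> x) k)" "\<forall>\<mu> x. degree (q \<mu> x) \<le> e" "\<forall>\<mu> x. poly (q \<mu> x) (x n) = G \<mu> x"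
    by blast
  have "homog n (d + e - k) (\<lambda>\<mu> x. coeff (p \<mu> x) i * coeff (q \<mu> x) (k - i))" if "i \<le> k" "k \<le> d + e" for i k
  \<comment> \<open>The degrees add up only where no natural subtraction truncates. In the other
    case one factor lies beyond its degree bound and the term is zero.\<close>
  proof (cases "i \<le> d \<and> k - i \<le> e")
    case True
    then have "d + e - k = (d - i) + (e - (k - i))" using that by arith
    with True p(1) q(1) show ?thesis
      by (simp only:) (rule homog.mult; simp)
  next
    case False
    have "coeff (p \<mu> x) i * coeff (q \<mu> x) (k - i) = 0" for \<mu> x
    proof -
      have "d < i \<or> e < k - i" using False by linarith
      then have "coeff (p \<mu> x) i = 0 \<or> coeff (q \<mu> x) (k - i) = 0"
        using coeff_eq_0 le_less_trans[OF p(2)[rule_format]] le_less_trans[OF q(2)[rule_format]] by blast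
      then show ?thesis by auto
    qed
    then show ?thesis by (simp add: homog.zero)
  qed
  then have "homog n (d + e - k) (\<lambda>\<mu> x. coeff (p \<mu> x * q \<mu> x) k)" if "k \<le> d + e" for k
    unfolding coeff_mult using that by (intro homog_sum) simp
  moreover have "degree (p \<mu> x * q \<mu> x) \<le> d + e" for \<mu> x
    using p(2) q(2) by (meson add_mono degree_mult_le order_trans)
  ultimately show ?case
    by (intro exI[of _ "\<lambda>\<mu> x. p \<mu> x * q \<mu> x"]) (use p q in simp)
qed

end

section \<open>Completeness of projective space\<close>

locale alg_closed_function_algebra = function_algebra R
  for R :: "('x \<Rightarrow> 'k::alg_closed_field) set"
begin

section \<open>Closed and conical families over a base\<close>

definition vanishing :: "'x set \<Rightarrow> ('x \<Rightarrow> (nat \<Rightarrow> 'k) \<Rightarrow> bool) \<Rightarrow> ('x \<Rightarrow> (nat \<Rightarrow> 'k) \<Rightarrow> 'k) \<Rightarrow> bool" where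
  "vanishing D X F \<longleftrightarrow> (\<forall>\<mu>\<in>D. \<forall>x. X \<mu> x \<longrightarrow> F \<mu> x = 0)"

text \<open>Relative Zariski closedness in \<open>D \<times> k\<^sup>n\<close>: only the first \<open>n\<close> entries of \<open>x\<close> are coordinates.\<close>
definition closed_family :: "nat \<Rightarrow> 'x set \<Rightarrow> ('x \<Rightarrow> (nat \<Rightarrow> 'k) \<Rightarrow> bool) \<Rightarrow> bool" where
  "closed_family n D X \<longleftrightarrow>
     (\<forall>\<mu>\<in>D. \<forall>x. \<not> X \<mu> x \<longrightarrow> (\<exists>F. polyfun n F \<and> vanishing D X F \<and> F \<mu> x \<noteq> 0))"

definition conical_family :: "'x set \<Rightarrow> ('x \<Rightarrow> (nat \<Rightarrow> 'k) \<Rightarrow> bool) \<Rightarrow> bool" where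
  "conical_family D X \<longleftrightarrow> (\<forall>\<mu>\<in>D. \<forall>x c. X \<mu> x \<longrightarrow> c \<noteq> 0 \<longrightarrow> X \<mu> (\<lambda>j. c * x j))"

text \<open>Over an infinite field the homogeneous components of an equation of a cone are
  themselves equations of the cone. They add up to F, so one of them is nonzero where F is.\<close>

lemma homogeneous_vanishing:
  assumes cone: "conical_family D X" and F: "polyfun n F" "vanishing D X F" "F \<mu> x \<noteq> 0"
  shows "\<exists>d G. homog n d G \<and> vanishing D X G \<and> G \<mu> x \<noteq> 0"
proof -
  obtain p m where p: "\<And>k. homog n k (\<lambda>\<mu> x. coeff (p \<mu> x) k)"
      "\<And>\<mu> x. degree (p \<mu> x) \<le> m" "\<And>\<mu> x. poly (p \<mu> x) 1 = F \<mu> x"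
    using polyfun_decompose[OF F(1)] by blast
  text \<open>The polynomial \<open>p \<nu> y\<close> records \<open>F\<close> along the line through \<open>y\<close>, so it is zero over a cone.\<close>
  have p_scale: "poly (p \<nu> y) c = F \<nu> (\<lambda>j. c * y j)" for \<nu> y c
  proof -
    have "poly (p \<nu> y) c = (\<Sum>k\<le>m. coeff (p \<nu> y) k * c ^ k)"
      by (rule poly_eq_sum_le[OF p(2)])
    also have "\<dots> = (\<Sum>k\<le>m. coeff (p \<nu> (\<lambda>j. c * y j)) k * 1 ^ k)"
      using homog_scale[OF p(1)] by (simp add: mult.commute)
    also have "\<dots> = F \<nu> (\<lambda>j. c * y j)"
      unfolding p(3)[symmetric] by (rule poly_eq_sum_le[OF p(2), symmetric])
    finally show ?thesis .
  qed
  have "p \<nu> y = 0" if "\<nu> \<in> D" "X \<nu> y" for \<nu> y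
  proof (rule ccontr)
    assume "p \<nu> y \<noteq> 0"
    then have "finite {c. poly (p \<nu> y) c = 0}" by (rule poly_roots_finite)
    moreover have "UNIV - {0} \<subseteq> {c. poly (p \<nu> y) c = 0}"
      using that cone F(2) unfolding p_scale conical_family_def vanishing_def by blast
    ultimately have "finite (UNIV - {0 :: 'k})" by (rule finite_subset[rotated])
    then show False using infinite_UNIV_alg_closed[where 'k = 'k] by simp
  qed
  then have van: "vanishing D X (\<lambda>\<mu> x. coeff (p \<mu> x) k)" for k
    by (simp add: vanishing_def)
  have "p \<mu> x \<noteq> 0" using F(3) p(3)[of \<mu> x] by auto
  then obtain k where "coeff (p \<mu> x) k \<noteq> 0" using leading_coeff_0_iff by blast
  with p(1)[of k] van[of k] show ?thesis by blast
qed

text \<open>A generic combination of equations avoids zero at finitely many points, since each point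
  excludes at most one scalar s in F + s G.\<close>

lemma common_vanishing:
  assumes "finite T" and "\<And>x. x \<in> T \<Longrightarrow> \<exists>F. polyfun n F \<and> vanishing D X F \<and> F \<mu> x \<noteq> 0"
  shows "\<exists>F. polyfun n F \<and> vanishing D X F \<and> (\<forall>x\<in>T. F \<mu> x \<noteq> 0)"
  using assms
proof (induction T)
  case empty
  show ?case
    by (intro exI[of _ "\<lambda>_ _. 0"]) (auto simp: vanishing_def intro: polyfun_const)
next
  case (insert y T)
  from insert.IH insert.prems obtain F where F: "polyfun n F" "vanishing D X F" "\<forall>x\<in>T. F \<mu> x \<noteq> 0"
    by auto
  from insert.prems obtain G where G: "polyfun n G" "vanishing D X G" "G \<mu> y \<noteq> 0" by blast
  \<comment> \<open>Where G vanishes the quotient is 0 by convention; this only excludes one further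
    scalar.\<close>
  have "finite ((\<lambda>x. - F \<mu> x / G \<mu> x) ` insert y T)" using insert.hyps by simp
  then obtain s where s: "s \<notin> (\<lambda>x. - F \<mu> x / G \<mu> x) ` insert y T"
    using ex_new_if_finite[OF infinite_UNIV_alg_closed] by blast
  have "F \<mu> x + s * G \<mu> x \<noteq> 0" if "x \<in> insert y T" for x
  proof (cases "G \<mu> x = 0")
    case True
    then show ?thesis using that F(3) G(3) by auto
  next
    case False
    show ?thesis
    proof
      assume "F \<mu> x + s * G \<mu> x = 0"
      then have "s = - F \<mu> x / G \<mu> x" using False by (simp add: field_simps add_eq_0_iff)
      with s that show False by blast
    qed
  qed
  moreover have "polyfun n (\<lambda>\<mu> x. F \<mu> x + s * G \<mu> x)"
    by (intro polyfun.add polyfun.mult polyfun_const F G)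
  moreover have "vanishing D X (\<lambda>\<mu> x. F \<mu> x + s * G \<mu> x)"
    using F(2) G(2) by (simp add: vanishing_def)
  ultimately show ?case by blast
qed

text \<open>
  This is the closedness of a finite map: over \<open>D'\<close> the equation \<open>p\<close> of \<open>X\<close> is monic in the last
  variable up to a unit. A fibre missing \<open>X\<close> has a second equation nonzero at all roots of \<open>p\<close>, and the
  resultant of the two separates the base point from the projection.
\<close>
lemma closed_family_project:
  assumes X: "closed_family (Suc n) D X" and D': "D' \<subseteq> D"
    and p: "\<And>k. polyfun n (\<lambda>\<mu> x. coeff (p \<mu> x) k)" "\<And>\<mu> x. degree (p \<mu> x) \<le> d"
    and lead: "\<And>\<mu> x. \<mu> \<in> D' \<Longrightarrow> coeff (p \<mu> x) d \<noteq> 0"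
    and p_van: "vanishing D X (\<lambda>\<mu> x. poly (p \<mu> x) (x n))"
  shows "closed_family n D' (\<lambda>\<mu> x. \<exists>t. X \<mu> (x(n := t)))"
  unfolding closed_family_def
proof (intro ballI allI impI)
  fix \<mu> x assume \<mu>: "\<mu> \<in> D'" and no: "\<not> (\<exists>t. X \<mu> (x(n := t)))"
  \<comment> \<open>Polynomials whose coefficients use only the first n coordinates are unaffected
    by a change of the coordinate with index n.\<close>
  have upd: "r \<mu> (x(n := t)) = r \<mu> x"
    if "\<And>k. polyfun n (\<lambda>\<mu> x. coeff (r \<mu> x) k)" for r :: "'x \<Rightarrow> (nat \<Rightarrow> 'k) \<Rightarrow> 'k poly" and \<mu> x t
    by (rule poly_eqI) (rule polyfun_cong[OF that], simp)
  have p0: "p \<nu> y \<noteq> 0" if "\<nu> \<in> D'" for \<nu> y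
    using lead[OF that, of y] by auto
  \<comment> \<open>On the line over the base point (\<mu>, x) only the finitely many roots of p
    have to be separated from X. None of these points lies in X, so each has an equation of X that
    is nonzero there.\<close>
  define T where "T = (\<lambda>t. x(n := t)) ` {t. poly (p \<mu> x) t = 0}"
  have "finite T"
    unfolding T_def using p0[OF \<mu>] by (intro finite_imageI poly_roots_finite)
  moreover have "\<exists>G. polyfun (Suc n) G \<and> vanishing D X G \<and> G \<mu> z \<noteq> 0" if "z \<in> T" for z
    using X no \<mu> D' that unfolding closed_family_def T_def by blast
  ultimately obtain G where G: "polyfun (Suc n) G" "vanishing D X G" "\<forall>z\<in>T. G \<mu> z \<noteq> 0"
    using common_vanishing[of T "Suc n" D X \<mu>] by blast
  obtain q m where q: "\<And>k. polyfun n (\<lambda>\<mu> x. coeff (q \<mu> x) k)"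
      "\<And>\<mu> x. degree (q \<mu> x) \<le> m" "\<And>\<mu> x. poly (q \<mu> x) (x n) = G \<mu> x"
    using polyfun_last[OF G(1)] by blast
  define r where "r = (\<lambda>\<mu> x. det (sylvester d m (p \<mu> x) (q \<mu> x)))"
  have "polyfun n r"
    unfolding r_def
  proof (rule polyfun_det[where N = "d + m"])
    fix i j assume ij: "i < d + m" "j < d + m"
    show "polyfun n (\<lambda>\<mu> x. sylvester d m (p \<mu> x) (q \<mu> x) $$ (i, j))"
    proof (cases "j < (if i < m then i else i - m)")
      case True
      then have "(\<lambda>\<mu> x. sylvester d m (p \<mu> x) (q \<mu> x) $$ (i, j)) = (\<lambda>_ _. 0)"
        using ij by (simp add: sylvester_def coeff_monom_mult)
      then show ?thesis by (simp add: polyfun_const)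
    next
      case False
      then show ?thesis
        using ij p(1) q(1) by (cases "i < m") (simp_all add: sylvester_def coeff_monom_mult)
    qed
  qed simp
  moreover have "vanishing D' (\<lambda>\<mu> x. \<exists>t. X \<mu> (x(n := t))) r"
    unfolding vanishing_def
  proof (intro ballI allI impI)
    fix \<nu> y assume \<nu>: "\<nu> \<in> D'" and "\<exists>t. X \<nu> (y(n := t))"
    then obtain t where t: "X \<nu> (y(n := t))" by blast
    have "poly (p \<nu> (y(n := t))) t = 0"
      using p_van t \<nu> D' unfolding vanishing_def by fastforce
    moreover have "poly (q \<nu> (y(n := t))) t = 0"
      using q(3)[of \<nu> "y(n := t)"] G(2) t \<nu> D' unfolding vanishing_def by auto
    ultimately show "r \<nu> y = 0"
      unfolding r_def upd[OF p(1)] upd[OF q(1)]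
      by (rule det_sylvester_eq_0[OF p(2) q(2) p0[OF \<nu>]])
  qed
  moreover have "r \<mu> x \<noteq> 0"
    unfolding r_def
  proof (rule det_sylvester_neq_0)
    show "degree (p \<mu> x) = d"
      using p(2) lead[OF \<mu>] by (intro antisym le_degree)
    show "poly (q \<mu> x) t \<noteq> 0" if "poly (p \<mu> x) t = 0" for t
    proof -
      have "G \<mu> (x(n := t)) \<noteq> 0" using G(3) that unfolding T_def by blast
      then show ?thesis using q(3)[of \<mu> "x(n := t)"] by (simp add: upd[OF q(1)])
    qed
  qed (use q(2) p0[OF \<mu>] in auto)
  ultimately show "\<exists>F. polyfun n F \<and> vanishing D' (\<lambda>\<mu> x. \<exists>t. X \<mu> (x(n := t))) F \<and> F \<mu> x \<noteq> 0"
    by blast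
qed

text \<open>Completeness of projective space in elementary form: the base points with a nonzero
  vector in their fibre are the projection of a closed subset of D times projective (n-1)-space, and
  f separates \<mu>0 from them.\<close>

theorem trivial_fibres_open:
  assumes "closed_family n D X" "conical_family D X"
    and "\<mu>0 \<in> D" "\<And>x. X \<mu>0 x \<Longrightarrow> \<forall>j<n. x j = 0"
  shows "\<exists>f\<in>R. f \<mu>0 \<noteq> 0 \<and> (\<forall>\<mu>\<in>D. f \<mu> \<noteq> 0 \<longrightarrow> (\<forall>x. X \<mu> x \<longrightarrow> (\<forall>j<n. x j = 0)))"
  using assms
proof (induction n arbitrary: D X)
  case 0
  show ?case by (intro bexI[of _ "\<lambda>_. 1"]) (simp_all add: const_mem)
next
  case (Suc n)
  define e where "e = (\<lambda>j. if j = n then 1 else 0 :: 'k)"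
  have "\<not> X \<mu>0 e" using Suc.prems(4)[of e] by (metis e_def lessI one_neq_zero)
  then obtain F' where F': "polyfun (Suc n) F'" "vanishing D X F'" "F' \<mu>0 e \<noteq> 0"
    using Suc.prems(1,3) unfolding closed_family_def by blast
  obtain d F where F: "homog (Suc n) d F" "vanishing D X F" "F \<mu>0 e \<noteq> 0"
    using homogeneous_vanishing[OF Suc.prems(2) F'] by blast
  obtain p where p: "\<And>k. k \<le> d \<Longrightarrow> homog n (d - k) (\<lambda>\<mu> x. coeff (p \<mu> x) k)"
      "\<And>\<mu> x. degree (p \<mu> x) \<le> d" "\<And>\<mu> x. poly (p \<mu> x) (x n) = F \<mu> x"
    using homog_last[OF F(1)] by blast
  have p_poly: "polyfun n (\<lambda>\<mu> x. coeff (p \<mu> x) k)" for k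
  proof (cases "k \<le> d")
    case True
    then show ?thesis using homog_imp_polyfun[OF p(1)] by blast
  next
    case False
    then have "(\<lambda>\<mu> x. coeff (p \<mu> x) k) = (\<lambda>_ _. 0)"
      using p(2) by (intro ext coeff_eq_0) (meson le_less_trans not_le)
    then show ?thesis by (simp add: polyfun_const)
  qed
  obtain h where h: "h \<in> R" "\<And>\<mu> x. coeff (p \<mu> x) d = h \<mu>"
    using homog_0_imp_coef[OF p(1)[of d]] by (auto simp: fun_eq_iff)
  \<comment> \<open>Along the last axis the coefficient of each lower power of x_n is homogeneous of
    positive degree and evaluated at the origin, hence zero.\<close>
  have F_axis: "F \<mu> x = h \<mu> * x n ^ d" if "\<forall>j<n. x j = 0" for \<mu> x
  proof -
    have "coeff (p \<mu> x) k = 0" if "k < d" for k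
    proof -
      have "coeff (p \<mu> x) k = coeff (p \<mu> (\<lambda>j. 0 * x j)) k"
        using \<open>\<forall>j<n. x j = 0\<close> by (intro polyfun_cong[OF p_poly]) simp
      also have "\<dots> = 0"
        using homog_scale[OF p(1)[of k], of \<mu> 0 x] that by simp
      finally show ?thesis .
    qed
    then have "F \<mu> x = (\<Sum>k\<le>d. if k = d then h \<mu> * x n ^ d else 0)"
      unfolding p(3)[symmetric] poly_eq_sum_le[OF p(2)] using h(2) by (intro sum.cong) auto
    then show ?thesis by simp
  qed
  have h0: "h \<mu>0 \<noteq> 0" using F(3) F_axis[of e \<mu>0] by (auto simp: e_def)
  define D' where "D' = {\<mu> \<in> D. h \<mu> \<noteq> 0}"
  define X' where "X' = (\<lambda>\<mu> x. \<exists>t. X \<mu> (x(n := t)))"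
  have "closed_family n D' X'"
    unfolding X'_def using Suc.prems(1) _ p_poly p(2)
  proof (rule closed_family_project)
    show "vanishing D X (\<lambda>\<mu> x. poly (p \<mu> x) (x n))"
      unfolding p(3) by (rule F(2))
  qed (auto simp: D'_def h(2))
  moreover have "conical_family D' X'"
    unfolding conical_family_def X'_def
  proof (intro ballI allI impI)
    fix \<mu> x c assume "\<mu> \<in> D'" "\<exists>t. X \<mu> (x(n := t))" "(c :: 'k) \<noteq> 0"
    then obtain t where "X \<mu> (\<lambda>j. c * (x(n := t)) j)"
      using Suc.prems(2) unfolding conical_family_def D'_def by blast
    moreover have "(\<lambda>j. c * (x(n := t)) j) = (\<lambda>j. c * x j)(n := c * t)" by auto
    ultimately show "\<exists>t. X \<mu> ((\<lambda>j. c * x j)(n := t))" by auto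
  qed
  moreover have "\<mu>0 \<in> D'" using Suc.prems(3) h0 by (simp add: D'_def)
  moreover have "\<forall>j<n. x j = 0" if "X' \<mu>0 x" for x
    using that Suc.prems(4) unfolding X'_def by (metis fun_upd_apply less_SucI less_irrefl)
  ultimately obtain f where f: "f \<in> R" "f \<mu>0 \<noteq> 0"
      "\<And>\<mu> x j. \<mu> \<in> D' \<Longrightarrow> f \<mu> \<noteq> 0 \<Longrightarrow> X' \<mu> x \<Longrightarrow> j < n \<Longrightarrow> x j = 0"
    using Suc.IH[of D' X'] by blast
  have "\<forall>j<Suc n. x j = 0" if \<mu>: "\<mu> \<in> D" "h \<mu> * f \<mu> \<noteq> 0" and x: "X \<mu> x" for \<mu> x
  proof -
    have "X' \<mu> x" unfolding X'_def using x by (intro exI[of _ "x n"]) simp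
    moreover have "\<mu> \<in> D'" using \<mu> by (simp add: D'_def)
    ultimately have z: "\<forall>j<n. x j = 0" using f(3) \<mu>(2) by auto
    \<comment> \<open>The induction hypothesis has put the point on the last axis, where F is known
      explicitly. For d = 0 the equation contradicts \<open>h \<mu> \<noteq> 0\<close>, so the fibre
      has no point at all.\<close>
    have "h \<mu> * x n ^ d = 0"
      using F(2) F_axis[OF z] x \<mu>(1) unfolding vanishing_def by metis
    then have "x n ^ d = 0" using \<mu>(2) by auto
    then have "x n = 0" by simp
    with z show ?thesis by (auto simp: less_Suc_eq)
  qed
  then show ?case
    using mult_mem[OF h(1) f(1)] h0 f(2) by (intro bexI[of _ "\<lambda>\<mu>. h \<mu> * f \<mu>"]) auto
qed

end

section \<open>Linear algebra\<close>

text \<open>The functionals are total linear maps, although they reproduce vectors only on Z. This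
  lets \<open>diff\<close> below be linear on the whole ambient space.\<close>

definition coordinates_on ::
  "('k::field \<Rightarrow> 'v::ab_group_add \<Rightarrow> 'v) \<Rightarrow> 'v set \<Rightarrow> nat \<Rightarrow> (nat \<Rightarrow> 'v) \<Rightarrow> (nat \<Rightarrow> 'v \<Rightarrow> 'k) \<Rightarrow> bool" where
  "coordinates_on scl Z N b \<phi> \<longleftrightarrow>
     (\<forall>k<N. b k \<in> Z) \<and> (\<forall>k. Vector_Spaces.linear scl (*) (\<phi> k)) \<and>
     (\<forall>k<N. \<forall>l<N. \<phi> k (b l) = (if k = l then 1 else 0)) \<and>
     (\<forall>v\<in>Z. (\<Sum>k<N. scl (\<phi> k v) (b k)) = v)"

section \<open>Quotients, splittings and bases of finite-dimensional subspaces\<close>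

context vector_space
begin

lemma finite_basis_of_subspace:
  assumes "subspace Z" "Z \<subseteq> span S" "finite S"
  obtains T where "finite T" "independent T" "span T = Z"
proof -
  obtain T where T: "T \<subseteq> Z" "independent T" "Z \<subseteq> span T"
    using basis_exists[of Z] by metis
  show ?thesis
  proof
    show "finite T"
      using independent_span_bound[of S T] T assms by blast
    show "span T = Z"
      using T(3) span_minimal[OF T(1) assms(1)] by (rule equalityI[rotated])
  qed fact
qed

text \<open>\<open>dim\<close> is a least size of finite generating sets, so its value can be
  exploited only once such a set is known; the cosets of a basis of Z provide one. Dimension 0 then
  means that the empty set generates, that is, that W is the only coset.\<close>

lemma dim_quotient_space_eq_0_iff:
  assumes Z: "subspace Z" and W: "subspace W" and fin: "Z \<subseteq> span S" "finite S"
  shows "vectorspace.dim (class_ring :: 'a ring) (quotient_space scale Z W) = 0 \<longleftrightarrow> Z \<subseteq> W"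
proof -
  let ?Q = "quotient_space scale Z W"
  interpret Q: vectorspace "class_ring :: 'a ring" ?Q
    by (rule vectorspace_quotient_space[OF Z W])
  define k where "k z = (\<lambda>w. z + w) ` W" for z
  have car: "carrier ?Q = k ` Z" and zero: "\<zero>\<^bsub>?Q\<^esub> = W"
    by (simp_all add: quotient_space_def k_def)
  have k_W: "k z = W \<longleftrightarrow> z \<in> W" for z
  proof
    assume "k z = W"
    moreover have "z + 0 \<in> k z" unfolding k_def using subspace_0[OF W] by (rule imageI)
    ultimately show "z \<in> W" by simp
  next
    assume z: "z \<in> W"
    have "w \<in> k z" if "w \<in> W" for w
      using subspace_diff[OF W that z] unfolding k_def by (intro image_eqI[of _ _ "w - z"]) auto
    with z show "k z = W" unfolding k_def by (auto intro: subspace_add[OF W])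
  qed
  have k_add: "k (x + y) = k x \<oplus>\<^bsub>?Q\<^esub> k y" for x y
  proof -
    have "t \<in> k (x + y) \<longleftrightarrow> t \<in> k x \<oplus>\<^bsub>?Q\<^esub> k y" for t
    proof
      assume "t \<in> k (x + y)"
      then obtain w where "w \<in> W" "t = (x + 0) + (y + w)" by (auto simp: k_def ac_simps)
      moreover have "x + 0 \<in> k x" unfolding k_def using subspace_0[OF W] by (rule imageI)
      ultimately show "t \<in> k x \<oplus>\<^bsub>?Q\<^esub> k y"
        unfolding quotient_space_def k_def by force
    next
      assume "t \<in> k x \<oplus>\<^bsub>?Q\<^esub> k y"
      then obtain v w where "v \<in> W" "w \<in> W" "t = (x + v) + (y + w)"
        by (auto simp: quotient_space_def k_def)
      then show "t \<in> k (x + y)"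
        using subspace_add[OF W, of v w] unfolding k_def
        by (intro image_eqI[of _ _ "v + w"]) (auto simp: ac_simps)
    qed
    then show ?thesis by blast
  qed
  have k_scale: "k (c *s x) = c \<odot>\<^bsub>?Q\<^esub> k x" for c x
  proof -
    have "t \<in> k (c *s x) \<longleftrightarrow> t \<in> c \<odot>\<^bsub>?Q\<^esub> k x" for t
    proof
      assume "t \<in> k (c *s x)"
      then obtain w where "w \<in> W" "t = c *s (x + 0) + w" by (auto simp: k_def)
      moreover have "x + 0 \<in> k x" unfolding k_def using subspace_0[OF W] by (rule imageI)
      ultimately show "t \<in> c \<odot>\<^bsub>?Q\<^esub> k x"
        unfolding quotient_space_def k_def by force
    next
      assume "t \<in> c \<odot>\<^bsub>?Q\<^esub> k x"
      then obtain v w where "v \<in> W" "w \<in> W" "t = c *s (x + v) + w"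
        by (auto simp: quotient_space_def k_def)
      then show "t \<in> k (c *s x)"
        using subspace_add[OF W subspace_scale[OF W], of v w c] unfolding k_def
        by (intro image_eqI[of _ _ "c *s v + w"]) (auto simp: scale_right_distrib ac_simps)
    qed
    then show ?thesis by blast
  qed
  obtain T where T: "finite T" "span T = Z"
    using finite_basis_of_subspace[OF Z fin] by blast
  have kT: "k ` T \<subseteq> carrier ?Q"
    unfolding car using T(2) span_superset by blast
  interpret sub: submodule "class_ring :: 'a ring" "Q.span (k ` T)" ?Q
    by (rule Q.span_is_submodule[OF kT])
  have "k z \<in> Q.span (k ` T)" if "z \<in> span T" for z
    using that
  proof (induction rule: span_induct_alt)
    case base
    show ?case using sub.zero_closed k_W[of 0] subspace_0[OF W] zero by metis
  next
    case (step c x y)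
    have "k x \<in> Q.span (k ` T)"
      using Q.in_own_span[OF kT] step(1) by blast
    then show ?case
      using step unfolding k_add k_scale by (intro sub.m_closed sub.smult_closed) simp_all
  qed
  then have gen: "Q.gen_set (k ` T)"
    using Q.span_is_subset2[OF kT] T(2) unfolding car by (intro equalityI) auto
  have "Q.gen_set {} \<longleftrightarrow> Z \<subseteq> W"
    using k_W subspace_0[OF Z] subspace_0[OF W] unfolding Q.span_empty car zero
    by (auto simp: image_iff)
  moreover have "Q.dim = 0 \<longleftrightarrow> Q.gen_set {}"
  proof
    assume "Q.dim = 0"
    have "\<exists>n A. finite A \<and> card A = n \<and> A \<subseteq> carrier ?Q \<and> Q.gen_set A"
      by (rule exI[of _ "card (k ` T)"], rule exI[of _ "k ` T"]) (intro conjI finite_imageI T(1) kT gen refl)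
    then have "\<exists>A. finite A \<and> card A = Q.dim \<and> A \<subseteq> carrier ?Q \<and> Q.gen_set A"
      unfolding Q.dim_def by (rule LeastI_ex)
    then obtain A where A: "finite A" "card A = Q.dim" "Q.gen_set A" by (elim exE conjE)
    then have "A = {}" using \<open>Q.dim = 0\<close> by simp
    with A(3) show "Q.gen_set {}" by simp
  next
    assume gen0: "Q.gen_set {}"
    show "Q.dim = 0"
      unfolding Q.dim_def
      by (rule Least_eq_0, rule exI[of _ "{}"]) (intro conjI finite.emptyI card.empty empty_subsetI gen0)
  qed
  ultimately show ?thesis by simp
qed

text \<open>A basis T of U is mapped to an independent set of the same size inside U. A vector of T
  outside the span of that image would enlarge it to an independent set with more elements than
  T.\<close>

lemma linear_inj_on_imp_surj_on:
  assumes f: "Vector_Spaces.linear scale scale f" and U: "subspace U" "U \<subseteq> span S" "finite S"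
    and inj: "inj_on f U" and sub: "f ` U \<subseteq> U"
  shows "f ` U = U"
proof -
  interpret f: Vector_Spaces.linear scale scale f by fact
  obtain T where T: "finite T" "independent T" "span T = U"
    using finite_basis_of_subspace[OF U] by blast
  have ind: "independent (f ` T)"
    using f.independent_injective_image[OF T(2)] inj T(3) by simp
  have fT: "f ` T \<subseteq> span T" using sub T(3) span_superset[of T] by auto
  have "T \<subseteq> span (f ` T)"
  proof
    fix t assume t: "t \<in> T"
    show "t \<in> span (f ` T)"
    proof (rule ccontr)
      assume nt: "t \<notin> span (f ` T)"
      have "card (insert t (f ` T)) \<le> card T"
        using independent_span_bound[OF T(1) independent_insertI[OF nt ind]] fT span_base[OF t] by simp
      moreover have "t \<notin> f ` T" using nt span_base by blast
      moreover have "card (f ` T) = card T"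
        using inj_on_subset[OF inj] span_superset[of T] T(3) by (intro card_image) simp
      ultimately show False using T(1) by simp
    qed
  qed
  then have "span T \<subseteq> span (f ` T)" by (rule span_minimal[OF _ subspace_span])
  then have "U \<subseteq> f ` U" unfolding f.span_image T(3) .
  with sub show ?thesis by (rule equalityI)
qed

text \<open>With sections g of \<alpha> and s of \<beta> and a projection \<pi> onto the image of P
  under \<alpha>, take h = g \<pi> and k = (1 - \<pi>) s. Then \<alpha> h = \<pi>, and k \<beta> q =
  q - \<pi> q because s \<beta> q - q is a cocycle, on which \<pi> is the identity by
  exactness.\<close>

lemma contracting_homotopy_exists:
  assumes \<alpha>: "Vector_Spaces.linear scale scale \<alpha>" and \<beta>: "Vector_Spaces.linear scale scale \<beta>"
    and P: "subspace P" and Q: "subspace Q"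
    and exact: "\<alpha> ` P = {q \<in> Q. \<beta> q = 0}"
  obtains h k where "Vector_Spaces.linear scale scale h" "Vector_Spaces.linear scale scale k"
    "range h \<subseteq> P" "range k \<subseteq> Q" "\<And>q. q \<in> Q \<Longrightarrow> \<alpha> (h q) + k (\<beta> q) = q"
proof -
  interpret pair: vector_space_pair scale scale by unfold_locales
  interpret \<alpha>: Vector_Spaces.linear scale scale \<alpha> by fact
  interpret \<beta>: Vector_Spaces.linear scale scale \<beta> by fact
  have K: "subspace (\<alpha> ` P)" by (rule \<alpha>.subspace_image[OF P])
  obtain g where g: "range g \<subseteq> P" "Vector_Spaces.linear scale scale g" "\<forall>v\<in>\<alpha> ` P. \<alpha> (g v) = v"
    using pair.linear_exists_right_inverse_on[OF \<alpha> P] by (elim exE conjE)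
  obtain s where s: "range s \<subseteq> Q" "Vector_Spaces.linear scale scale s" "\<forall>v\<in>\<beta> ` Q. \<beta> (s v) = v"
    using pair.linear_exists_right_inverse_on[OF \<beta> Q] by (elim exE conjE)
  have id: "Vector_Spaces.linear scale scale id" by (rule linear_id)
  \<comment> \<open>A left inverse of the identity on a subspace, with range in that subspace, is a
    projection onto it.\<close>
  obtain \<pi> where \<pi>: "range \<pi> \<subseteq> \<alpha> ` P" "Vector_Spaces.linear scale scale \<pi>" "\<forall>v\<in>\<alpha> ` P. \<pi> (id v) = v"
    using pair.linear_exists_left_inverse_on[OF id K inj_on_id] by (elim exE conjE)
  interpret \<pi>: Vector_Spaces.linear scale scale \<pi> by fact
  show ?thesis
  proof
    show "Vector_Spaces.linear scale scale (g \<circ> \<pi>)"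
      by (rule Vector_Spaces.linear_compose[OF \<pi>(2) g(2)])
    have "Vector_Spaces.linear scale scale (\<pi> \<circ> s)"
      by (rule Vector_Spaces.linear_compose[OF s(2) \<pi>(2)])
    then show "Vector_Spaces.linear scale scale (\<lambda>v. s v - \<pi> (s v))"
      using pair.linear_compose_sub[OF s(2), of "\<pi> \<circ> s"] by (simp add: o_def)
    show "range (g \<circ> \<pi>) \<subseteq> P" using g(1) by auto
    show "range (\<lambda>v. s v - \<pi> (s v)) \<subseteq> Q"
      using s(1) \<pi>(1) exact by (auto intro!: subspace_diff[OF Q])
    fix q assume q: "q \<in> Q"
    have "s (\<beta> q) - q \<in> \<alpha> ` P"
    proof -
      have "s (\<beta> q) \<in> Q" using s(1) by (rule subsetD) (rule rangeI)
      moreover have "\<beta> (s (\<beta> q)) = \<beta> q" using s(3) q by simp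
      ultimately show ?thesis
        unfolding exact using subspace_diff[OF Q _ q] by (simp add: \<beta>.diff)
    qed
    then have "\<pi> (s (\<beta> q)) - \<pi> q = s (\<beta> q) - q"
      using \<pi>(3)[rule_format, of "s (\<beta> q) - q"] by (simp add: \<pi>.diff)
    then have "s (\<beta> q) - \<pi> (s (\<beta> q)) = q - \<pi> q" by (simp add: algebra_simps)
    moreover have "\<alpha> (g (\<pi> q)) = \<pi> q" using \<pi>(1) by (intro g(3)[rule_format]) (rule subsetD, assumption, rule rangeI)
    ultimately show "\<alpha> ((g \<circ> \<pi>) q) + (s (\<beta> q) - \<pi> (s (\<beta> q))) = q" by simp
  qed
qed

lemma coordinates_exist:
  assumes "finite S" "Z = span S"
  shows "\<exists>N b \<phi>. coordinates_on scale Z N b \<phi>"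
proof -
  obtain T where T: "finite T" "independent T" "span T = Z"
    using finite_basis_of_subspace[of Z S] assms by auto
  obtain b where b: "bij_betw b {..<card T} T"
    using T(1) bij_betw_from_nat_into_finite lessThan_atLeast0 ex_bij_betw_nat_finite by metis
  \<comment> \<open>Representing vectors in a basis of the whole space that contains T makes the
    coordinate functionals total.\<close>
  let ?E = "extend_basis T"
  define \<phi> where "\<phi> k v = representation ?E v (b k)" for k v
  note E = independent_extend_basis[OF T(2)] span_extend_basis[OF T(2)] extend_basis_superset[OF T(2)]
  have bT: "b k \<in> T" if "k < card T" for k using b that by (auto dest: bij_betwE)
  have vs: "vector_space ((*) :: 'a \<Rightarrow> 'a \<Rightarrow> 'a)"
    by unfold_locales (simp_all add: algebra_simps)
  show ?thesis
    unfolding coordinates_on_def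
  proof (intro exI[of _ "card T"] exI[of _ b] exI[of _ \<phi>] conjI allI impI ballI)
    show "b k \<in> Z" if "k < card T" for k
      using bT[OF that] T(3) span_superset by blast
    show "Vector_Spaces.linear scale (*) (\<phi> k)" for k
      unfolding \<phi>_def Vector_Spaces.linear_iff using E(1,2) vs
      by (simp add: representation_add representation_scale vector_space_axioms)
    show "\<phi> k (b l) = (if k = l then 1 else 0)" if "k < card T" "l < card T" for k l
    proof -
      have "b l \<in> ?E" using bT[OF that(2)] E(3) by blast
      moreover have "b k = b l \<longleftrightarrow> k = l" using b that by (auto simp: bij_betw_def inj_on_def)
      ultimately show ?thesis
        unfolding \<phi>_def using representation_basis[OF E(1)] by simp
    qed
    fix v assume "v \<in> Z"
    then have v: "v \<in> span T" using T(3) by simp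
    have "representation ?E v = representation T v"
      by (rule representation_extend[OF E(1) v E(3)])
    then have "(\<Sum>k<card T. \<phi> k v *s b k) = (\<Sum>k<card T. representation T v (b k) *s b k)"
      by (simp add: \<phi>_def)
    also have "\<dots> = (\<Sum>w\<in>T. representation T v w *s w)"
      by (rule sum.reindex_bij_betw[OF b])
    also have "\<dots> = v"
      using sum_representation_eq[OF T(2) v T(1)] by simp
    finally show "(\<Sum>k<card T. \<phi> k v *s b k) = v" .
  qed
qed

end

section \<open>Resonance in coordinates\<close>

locale graded_coordinates = connected_graded_space scl B u
  for scl :: "'k::field \<Rightarrow> 'v::ab_group_add \<Rightarrow> 'v" and B :: "nat \<Rightarrow> 'v set" and u :: 'v +
  fixes N :: "nat \<Rightarrow> nat" and b :: "nat \<Rightarrow> nat \<Rightarrow> 'v" and \<phi> :: "nat \<Rightarrow> nat \<Rightarrow> 'v \<Rightarrow> 'k"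
  assumes coordinates: "coordinates_on scl (B q) (N q) (b q) (\<phi> q)"
begin

lemma b_mem: "k < N q \<Longrightarrow> b q k \<in> B q"
  and linear_coord: "Vector_Spaces.linear scl (*) (\<phi> q k)"
  and coord_b: "k < N q \<Longrightarrow> l < N q \<Longrightarrow> \<phi> q k (b q l) = (if k = l then 1 else 0)"
  and expand: "v \<in> B q \<Longrightarrow> (\<Sum>k<N q. scl (\<phi> q k v) (b q k)) = v"
  using coordinates[of q] unfolding coordinates_on_def by blast+

abbreviation "coeff_ring \<equiv> poly_funs (mult_scale scl) (mult_space scl B)"

abbreviation "algebras \<equiv> cga_space scl B u"

abbreviation "prod_of \<equiv> full_mult scl u"

section \<open>The differential in coordinates\<close>

definition vec1 :: "(nat \<Rightarrow> 'k) \<Rightarrow> 'v" where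
  "vec1 x = (\<Sum>j<N 1. scl (x j) (b 1 j))"

text \<open>
  Left multiplication by \<open>vec1 x\<close>, written in coordinates so that it is linear on the whole ambient
  space and polynomial in \<open>(\<mu>, x)\<close> even where \<open>\<mu>\<close> is not an algebra.
\<close>
definition diff :: "nat \<Rightarrow> 'v mult_family \<Rightarrow> (nat \<Rightarrow> 'k) \<Rightarrow> 'v \<Rightarrow> 'v" where
  "diff q \<mu> x v = (\<Sum>k<N q. scl (\<phi> q k v) (\<Sum>j<N 1. scl (x j) (prod_of \<mu> 1 q (b 1 j) (b q k))))"

sublocale coord: Vector_Spaces.linear scl "(*)" "\<phi> q k" for q k
  by (rule linear_coord)

lemma linear_diff: "Vector_Spaces.linear scl scl (diff q \<mu> x)"
  unfolding diff_def Vector_Spaces.linear_iff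
  by (simp add: vector_space_axioms coord.add coord.scale scale_left_distrib sum.distrib scale_sum_right
      distrib_right)

lemma vec1_mem: "vec1 x \<in> B 1"
  unfolding vec1_def by (intro subspace_sum[OF subspace_B] subspace_scale[OF subspace_B] b_mem) simp

lemma vec1_coord: "a \<in> B 1 \<Longrightarrow> vec1 (\<lambda>j. \<phi> 1 j a) = a"
  unfolding vec1_def by (rule expand)

lemma coord_vec1: "j < N 1 \<Longrightarrow> \<phi> 1 j (vec1 x) = x j"
  unfolding vec1_def by (simp add: coord.sum coord.scale coord_b if_distrib cong: if_cong)

lemma vec1_eq_0_iff: "vec1 x = 0 \<longleftrightarrow> (\<forall>j<N 1. x j = 0)"
proof
  assume "vec1 x = 0"
  then show "\<forall>j<N 1. x j = 0" using coord_vec1 coord.zero by metis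
qed (simp add: vec1_def)

lemma bilinear_prod_of: "\<mu> \<in> algebras \<Longrightarrow> bilinear_on scl (B p) (B q) (B (p + q)) (prod_of \<mu> p q)"
  by (simp add: cga_space_def cga_def)

lemma bilinear_on_sum_left:
  assumes f: "bilinear_on scl (B p) (B q) Z f" and "finite A" "\<And>j. j \<in> A \<Longrightarrow> e j \<in> B p" "v \<in> B q"
  shows "f (\<Sum>j\<in>A. scl (c j) (e j)) v = (\<Sum>j\<in>A. scl (c j) (f (e j) v))"
  using assms(2,3)
proof (induction A)
  case empty
  have "f (scl 0 0) v = scl 0 (f 0 v)"
    using f \<open>v \<in> B q\<close> subspace_0[OF subspace_B] unfolding bilinear_on_def by blast
  then show ?case by simp
next
  case (insert j A)
  have "scl (c j) (e j) \<in> B p" "(\<Sum>j\<in>A. scl (c j) (e j)) \<in> B p"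
    using insert.prems by (auto intro!: subspace_sum[OF subspace_B] subspace_scale[OF subspace_B])
  then have "f (scl (c j) (e j) + (\<Sum>j\<in>A. scl (c j) (e j))) v =
      f (scl (c j) (e j)) v + f (\<Sum>j\<in>A. scl (c j) (e j)) v"
    using f \<open>v \<in> B q\<close> unfolding bilinear_on_def by blast
  moreover have "f (scl (c j) (e j)) v = scl (c j) (f (e j) v)"
    using f \<open>v \<in> B q\<close> insert.prems unfolding bilinear_on_def by blast
  ultimately show ?case using insert by simp
qed

lemma bilinear_on_sum_right:
  assumes f: "bilinear_on scl (B p) (B q) Z f" and "finite A" "\<And>j. j \<in> A \<Longrightarrow> e j \<in> B q" "v \<in> B p"
  shows "f v (\<Sum>j\<in>A. scl (c j) (e j)) = (\<Sum>j\<in>A. scl (c j) (f v (e j)))"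
proof -
  have "bilinear_on scl (B q) (B p) Z (\<lambda>x y. f y x)"
    using f unfolding bilinear_on_def by simp
  from bilinear_on_sum_left[OF this assms(2-4)] show ?thesis .
qed

lemma prod_of_vec1:
  assumes \<mu>: "\<mu> \<in> algebras" and v: "v \<in> B q"
  shows "prod_of \<mu> 1 q (vec1 x) v = diff q \<mu> x v"
proof -
  have "prod_of \<mu> 1 q (vec1 x) v = prod_of \<mu> 1 q (vec1 x) (\<Sum>k<N q. scl (\<phi> q k v) (b q k))"
    by (simp add: expand[OF v])
  also have "\<dots> = (\<Sum>k<N q. scl (\<phi> q k v) (prod_of \<mu> 1 q (vec1 x) (b q k)))"
    by (rule bilinear_on_sum_right[OF bilinear_prod_of[OF \<mu>]]) (auto intro: b_mem vec1_mem simp del: One_nat_def)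
  also have "\<dots> = diff q \<mu> x v"
    unfolding diff_def vec1_def
    by (intro sum.cong refl arg_cong[where f = "scl _"] bilinear_on_sum_left[OF bilinear_prod_of[OF \<mu>]])
      (auto intro: b_mem simp del: One_nat_def)
  finally show ?thesis .
qed

lemma diff_mem:
  assumes "\<mu> \<in> algebras" "v \<in> B q"
  shows "diff q \<mu> x v \<in> B (Suc q)"
  using bilinear_prod_of[OF assms(1), of 1 q] vec1_mem[of x] assms(2)
  unfolding prod_of_vec1[OF assms, symmetric] bilinear_on_def by simp

text \<open>By associativity a (a v) = (a a) v, which is zero once a a = 0.\<close>

lemma diff_diff:
  assumes \<mu>: "\<mu> \<in> algebras" and sq: "diff 1 \<mu> x (vec1 x) = 0" and v: "v \<in> B q"
  shows "diff (Suc q) \<mu> x (diff q \<mu> x v) = 0"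
proof -
  let ?a = "vec1 x"
  have "prod_of \<mu> (1 + 1) q (prod_of \<mu> 1 1 ?a ?a) v = prod_of \<mu> 1 (1 + q) ?a (prod_of \<mu> 1 q ?a v)"
    using \<mu> v vec1_mem[of x] unfolding cga_space_def cga_def by blast
  also have "prod_of \<mu> 1 1 ?a ?a = 0" using sq prod_of_vec1[OF \<mu> vec1_mem] by simp
  also have "prod_of \<mu> (1 + 1) q 0 v = 0"
    using bilinear_on_sum_left[OF bilinear_prod_of[OF \<mu>], of "{}" _ "1 + 1"] v by simp
  finally have "prod_of \<mu> 1 (Suc q) ?a (prod_of \<mu> 1 q ?a v) = 0" by (simp only: plus_1_eq_Suc)
  then show ?thesis
    unfolding prod_of_vec1[OF \<mu> v] prod_of_vec1[OF \<mu> diff_mem[OF \<mu> v]] .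
qed

lemma diff_scale: "diff q \<mu> (\<lambda>j. c * x j) v = scl c (diff q \<mu> x v)"
  by (simp only: diff_def scale_sum_right scale_scale mult.assoc mult.left_commute)

text \<open>For i >= 1 the coboundaries are a genuine image, and cohomology of dimension at least 1
  means a cocycle that is no coboundary. Resonance thus becomes a condition on the maps
  \<open>diff\<close> alone.\<close>

lemma resonance_iff:
  assumes \<mu>: "\<mu> \<in> algebras" and i: "i \<ge> 1"
  shows "vec1 x \<in> resonance scl B (prod_of \<mu>) i 1 \<longleftrightarrow>
    diff 1 \<mu> x (vec1 x) = 0 \<and> \<not> {v \<in> B i. diff i \<mu> x v = 0} \<subseteq> diff (i - 1) \<mu> x ` B (i - 1)"
proof -
  interpret di: Vector_Spaces.linear scl scl "diff q \<mu> x" for q by (rule linear_diff)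
  have Z: "cocycles B (prod_of \<mu>) (vec1 x) i = {v \<in> B i. diff i \<mu> x v = 0}"
    unfolding cocycles_def using prod_of_vec1[OF \<mu>] by auto
  have W: "coboundaries B (prod_of \<mu>) (vec1 x) i = diff (i - 1) \<mu> x ` B (i - 1)"
    unfolding coboundaries_def using prod_of_vec1[OF \<mu>] i by (simp cong: image_cong)
  have "subspace {v \<in> B i. diff i \<mu> x v = 0}"
    using subspace_inter[OF subspace_B di.subspace_kernel] by (simp add: Int_def)
  moreover have "subspace (diff (i - 1) \<mu> x ` B (i - 1))"
    by (rule di.subspace_image[OF subspace_B])
  moreover obtain S where "finite S" "B i = span S" using finite_dim_B by blast
  ultimately have "vectorspace.dim (class_ring :: 'k ring) (cohomology scl B (prod_of \<mu>) (vec1 x) i) = 0 \<longleftrightarrow>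
      {v \<in> B i. diff i \<mu> x v = 0} \<subseteq> diff (i - 1) \<mu> x ` B (i - 1)"
    unfolding cohomology_def Z W by (intro dim_quotient_space_eq_0_iff) auto
  then show ?thesis
    unfolding resonance_def using vec1_mem prod_of_vec1[OF \<mu> vec1_mem] by auto
qed

text \<open>A nonzero factor on a multiplies the differential by a unit, which changes neither its
  kernel nor its image.\<close>

lemma resonance_scale:
  assumes \<mu>: "\<mu> \<in> algebras" and i: "i \<ge> 1" and c: "c \<noteq> 0"
    and x: "vec1 x \<in> resonance scl B (prod_of \<mu>) i 1"
  shows "vec1 (\<lambda>j. c * x j) \<in> resonance scl B (prod_of \<mu>) i 1"
proof -
  interpret d: Vector_Spaces.linear scl scl "diff q \<mu> x" for q by (rule linear_diff)
  have "vec1 (\<lambda>j. c * x j) = scl c (vec1 x)"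
    by (simp add: vec1_def scale_sum_right)
  moreover have "(\<lambda>v. scl c (diff q \<mu> x v)) ` B q = diff q \<mu> x ` B q" for q
  proof -
    have "diff q \<mu> x v \<in> (\<lambda>v. scl c (diff q \<mu> x v)) ` B q" if "v \<in> B q" for v
      using c subspace_scale[OF subspace_B that, of "inverse c"]
      by (intro image_eqI[of _ _ "scl (inverse c) v"]) (simp_all add: d.scale)
    moreover have "scl c (diff q \<mu> x v) \<in> diff q \<mu> x ` B q" if "v \<in> B q" for v
      using subspace_scale[OF subspace_B that, of c] by (simp add: d.scale[symmetric])
    ultimately show ?thesis by blast
  qed
  ultimately show ?thesis
    using x c unfolding resonance_iff[OF \<mu> i] diff_scale by (simp add: d.scale)
qed

section \<open>Polynomial dependence on the algebra and on the degree 1 element\<close>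

sublocale coeffs: function_algebra coeff_ring
  by unfold_locales (rule poly_funs.const poly_funs.add poly_funs.mult; assumption)+

text \<open>The product with an element of degree 0 does not involve \<mu>, which leaves a constant;
  for q >= 1, evaluation at fixed arguments is linear in \<mu>.\<close>

lemma coord_prod_of_mem:
  assumes "Vector_Spaces.linear scl (*) f"
  shows "(\<lambda>\<mu>. f (prod_of \<mu> 1 q e v)) \<in> coeff_ring"
proof (cases "q = 0")
  case True
  then show ?thesis by (simp add: full_mult_def poly_funs.const)
next
  case False
  interpret f: Vector_Spaces.linear scl "(*)" f by fact
  have "linear_functional_on (mult_scale scl) (mult_space scl B) (\<lambda>\<mu>. f (prod_of \<mu> 1 q e v))"
    using False
    by (simp add: linear_functional_on_def full_mult_def mult_scale_def f.add f.scale)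
  then show ?thesis by (rule poly_funs.linear)
qed

lemma polyfun_diff:
  assumes "Vector_Spaces.linear scl (*) f"
  shows "coeffs.polyfun (N 1) (\<lambda>\<mu> x. f (diff q \<mu> x v))"
proof -
  interpret f: Vector_Spaces.linear scl "(*)" f by fact
  show ?thesis
    unfolding diff_def f.sum f.scale
    by (intro coeffs.polyfun_sum coeffs.polyfun.mult coeffs.polyfun_const coeffs.polyfun.coef
        coeffs.polyfun.var coord_prod_of_mem assms) simp
qed

lemma polyfun_square:
  assumes "Vector_Spaces.linear scl (*) f"
  shows "coeffs.polyfun (N 1) (\<lambda>\<mu> x. f (diff 1 \<mu> x (vec1 x)))"
proof -
  interpret f: Vector_Spaces.linear scl "(*)" f by fact
  have eq: "f (diff 1 \<mu> x (vec1 x)) = (\<Sum>l<N 1. x l * f (diff 1 \<mu> x (b 1 l)))" for \<mu> x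
  proof -
    interpret d: Vector_Spaces.linear scl scl "diff 1 \<mu> x" by (rule linear_diff)
    show ?thesis by (simp add: vec1_def d.sum d.scale f.sum f.scale del: One_nat_def)
  qed
  show ?thesis
    unfolding eq
    by (intro coeffs.polyfun_sum coeffs.polyfun.mult coeffs.polyfun.var polyfun_diff assms) simp
qed

text \<open>
  For a complex, if \<open>d h + k d\<close> is injective in the middle, then so is its restriction to the
  coboundaries, which is therefore onto them; it sends cocycles to coboundaries, so they agree.
\<close>
lemma exact_if_homotopy_inj:
  assumes \<alpha>: "Vector_Spaces.linear scl scl \<alpha>" and \<beta>: "Vector_Spaces.linear scl scl \<beta>"
    and h: "Vector_Spaces.linear scl scl h" "range h \<subseteq> B p" and k: "Vector_Spaces.linear scl scl k"
    and \<alpha>B: "\<alpha> ` B p \<subseteq> B q" and \<beta>\<alpha>: "\<And>v. v \<in> B p \<Longrightarrow> \<beta> (\<alpha> v) = 0"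
    and inj: "inj_on (\<lambda>v. \<alpha> (h v) + k (\<beta> v)) (B q)"
  shows "{v \<in> B q. \<beta> v = 0} \<subseteq> \<alpha> ` B p"
proof
  interpret \<alpha>: Vector_Spaces.linear scl scl \<alpha> by fact
  interpret \<beta>: Vector_Spaces.linear scl scl \<beta> by fact
  interpret h: Vector_Spaces.linear scl scl h by fact
  interpret k: Vector_Spaces.linear scl scl k by fact
  let ?\<Psi> = "\<lambda>v. \<alpha> (h v) + k (\<beta> v)"
  have \<Psi>: "Vector_Spaces.linear scl scl ?\<Psi>"
    unfolding Vector_Spaces.linear_iff
    by (simp add: vector_space_axioms \<alpha>.add \<alpha>.scale \<beta>.add \<beta>.scale h.add h.scale k.add k.scale
        scale_right_distrib)
  obtain S where S: "finite S" "B q = span S" using finite_dim_B by blast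
  have to_im: "?\<Psi> v \<in> \<alpha> ` B p" if "\<beta> v = 0" for v
    using that h(2) by auto
  have "?\<Psi> ` \<alpha> ` B p \<subseteq> \<alpha> ` B p"
    using to_im \<beta>\<alpha> by blast
  then have onto: "?\<Psi> ` \<alpha> ` B p = \<alpha> ` B p"
    using linear_inj_on_imp_surj_on[OF \<Psi> \<alpha>.subspace_image[OF subspace_B] _ S(1)] \<alpha>B
      inj_on_subset[OF inj \<alpha>B] S(2) by blast
  fix v assume v: "v \<in> {v \<in> B q. \<beta> v = 0}"
  then have "?\<Psi> v \<in> ?\<Psi> ` \<alpha> ` B p" unfolding onto using to_im by blast
  then obtain w where w: "w \<in> \<alpha> ` B p" "?\<Psi> v = ?\<Psi> w" by blast
  then have "v = w" using inj v \<alpha>B unfolding inj_on_def by blast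
  with w(1) show "v \<in> \<alpha> ` B p" by simp
qed

text \<open>A vector of \<open>B q\<close> killed by f has its coordinate vector in the kernel of
  the matrix. The matrix sees only the coordinates \<open>\<phi> q r\<close> of the values of f,
  which make sense outside \<open>B q\<close> as well.\<close>

lemma inj_on_if_det:
  assumes f: "Vector_Spaces.linear scl scl f"
    and det: "det (mat (N q) (N q) (\<lambda>(r, c). \<phi> q r (f (b q c)))) \<noteq> 0"
  shows "inj_on f (B q)"
proof -
  interpret f: Vector_Spaces.linear scl scl f by fact
  let ?M = "mat (N q) (N q) (\<lambda>(r, c). \<phi> q r (f (b q c)))"
  have "v = 0" if v: "v \<in> B q" "f v = 0" for v
  proof -
    let ?w = "vec (N q) (\<lambda>c. \<phi> q c v)"
    have "?M *\<^sub>v ?w = 0\<^sub>v (N q)"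
    proof (intro eq_vecI)
      fix r assume "r < dim_vec (0\<^sub>v (N q) :: 'k vec)"
      then have r: "r < N q" by simp
      have "0 = \<phi> q r (f (\<Sum>c<N q. scl (\<phi> q c v) (b q c)))"
        using v expand by (simp add: coord.zero)
      also have "\<dots> = (\<Sum>c<N q. \<phi> q c v * \<phi> q r (f (b q c)))"
        by (simp add: f.sum f.scale coord.sum coord.scale)
      finally show "(?M *\<^sub>v ?w) $ r = 0\<^sub>v (N q) $ r"
        using r by (simp add: scalar_prod_def atLeast0LessThan mult.commute)
    qed simp
    then have w: "?w = 0\<^sub>v (N q)"
      using det det_0_iff_vec_prod_zero_field[of ?M "N q"] vec_carrier mat_carrier by metis
    have "\<phi> q c v = 0" if "c < N q" for c
    proof -
      have "?w $ c = 0" unfolding w using that by simp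
      then show ?thesis using that by simp
    qed
    then show "v = 0" using expand[OF v(1)] by simp
  qed
  then show ?thesis
    unfolding f.inj_on_iff_eq_0[OF subspace_B] by (intro ballI impI)
qed

end

lemma (in connected_graded_space) graded_coordinates_exist:
  "\<exists>N b \<phi>. graded_coordinates scl B u N b \<phi>"
proof -
  have "\<forall>q. \<exists>N b \<phi>. coordinates_on scl (B q) N b \<phi>"
    using finite_dim_B coordinates_exist by metis
  then obtain N b \<phi> where "\<And>q. coordinates_on scl (B q) (N q) (b q) (\<phi> q)" by metis
  then show ?thesis by (intro exI) (rule graded_coordinates.intro[OF connected_graded_space_axioms], rule graded_coordinates_axioms.intro)
qed

section \<open>Openness of trivial resonance\<close>

locale alg_closed_graded_coordinates = graded_coordinates scl B u N b \<phi>
  for scl :: "'k::alg_closed_field \<Rightarrow> 'v::ab_group_add \<Rightarrow> 'v" and B u N b \<phi>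
begin

sublocale coeffs: alg_closed_function_algebra coeff_ring
  by unfold_locales

lemma closed_family_resonance:
  assumes i: "i \<ge> 1"
  shows "coeffs.closed_family (N 1) algebras (\<lambda>\<mu> x. vec1 x \<in> resonance scl B (prod_of \<mu>) i 1)"
  unfolding coeffs.closed_family_def
proof (intro ballI allI impI)
  let ?X = "\<lambda>\<mu> x. vec1 x \<in> resonance scl B (prod_of \<mu>) i 1"
  obtain p where p: "i = Suc p" using i by (cases i) auto
  fix \<mu> x assume \<mu>: "\<mu> \<in> algebras" and "vec1 x \<notin> resonance scl B (prod_of \<mu>) i 1"
  then consider "diff 1 \<mu> x (vec1 x) \<noteq> 0"
    | "diff 1 \<mu> x (vec1 x) = 0" "{v \<in> B i. diff i \<mu> x v = 0} \<subseteq> diff p \<mu> x ` B p"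
    using resonance_iff[OF \<mu> i, of x] p by auto
  then show "\<exists>F. coeffs.polyfun (N 1) F \<and> coeffs.vanishing algebras ?X F \<and> F \<mu> x \<noteq> 0"
  proof cases
    \<comment> \<open>Some coordinate of a a is nonzero at (\<mu>, x), while all of them vanish on
      the resonance family.\<close>
    case 1
    have "diff 1 \<mu> x (vec1 x) \<in> B 2"
      using diff_mem[OF \<mu> vec1_mem, of x x] by (simp add: numeral_2_eq_2)
    then have "(\<Sum>k<N 2. scl (\<phi> 2 k (diff 1 \<mu> x (vec1 x))) (b 2 k)) \<noteq> 0"
      using expand 1 by simp
    then obtain k where k: "\<phi> 2 k (diff 1 \<mu> x (vec1 x)) \<noteq> 0"
      by (metis (no_types, lifting) scale_eq_0_iff sum.neutral)
    have "coeffs.vanishing algebras ?X (\<lambda>\<mu> x. \<phi> 2 k (diff 1 \<mu> x (vec1 x)))"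
      using resonance_iff[OF _ i] by (simp add: coeffs.vanishing_def coord.zero)
    with k polyfun_square[OF linear_coord] show ?thesis
      by (intro exI[of _ "\<lambda>\<mu> x. \<phi> 2 k (diff 1 \<mu> x (vec1 x))"] conjI)
  next
    case 2
    have exact: "diff p \<mu> x ` B p = {v \<in> B i. diff i \<mu> x v = 0}"
      using 2(2) diff_mem[OF \<mu>, of _ p x] diff_diff[OF \<mu> 2(1), of _ p] unfolding p
      by (intro equalityI) auto
    obtain h k where hk: "Vector_Spaces.linear scl scl h" "Vector_Spaces.linear scl scl k"
        "range h \<subseteq> B p" "range k \<subseteq> B i"
        "\<And>v. v \<in> B i \<Longrightarrow> diff p \<mu> x (h v) + k (diff i \<mu> x v) = v"
      by (rule contracting_homotopy_exists[OF linear_diff linear_diff subspace_B subspace_B exact])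
        (rule that)
    interpret h: Vector_Spaces.linear scl scl h by (rule hk(1))
    interpret k: Vector_Spaces.linear scl scl k by (rule hk(2))
    \<comment> \<open>The homotopy h, k stays frozen at the one found for (\<mu>, x); only the
      differentials move with (\<nu>, y). Hence the determinant is polynomial in (\<nu>, y), and at
      (\<mu>, x) the matrix is the identity.\<close>
    define \<Psi> where "\<Psi> \<nu> y v = diff p \<nu> y (h v) + k (diff i \<nu> y v)" for \<nu> y v
    define M where "M \<nu> y = mat (N i) (N i) (\<lambda>(r, c). \<phi> i r (\<Psi> \<nu> y (b i c)))" for \<nu> y
    have "coeffs.polyfun (N 1) (\<lambda>\<nu> y. det (M \<nu> y))"
    proof (rule coeffs.polyfun_det)
      show "M \<nu> y \<in> carrier_mat (N i) (N i)" for \<nu> y by (simp add: M_def)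
      fix r c assume rc: "r < N i" "c < N i"
      have "Vector_Spaces.linear scl (*) (\<phi> i r \<circ> k)"
        by (rule Vector_Spaces.linear_compose[OF hk(2) linear_coord])
      from coeffs.polyfun.add[OF polyfun_diff[OF linear_coord] polyfun_diff[OF this]]
      show "coeffs.polyfun (N 1) (\<lambda>\<nu> y. M \<nu> y $$ (r, c))"
        using rc by (simp add: M_def \<Psi>_def coord.add)
    qed
    moreover have "det (M \<mu> x) \<noteq> 0"
    proof -
      have "M \<mu> x = 1\<^sub>m (N i)"
        by (rule eq_matI) (simp_all add: M_def \<Psi>_def hk(5) b_mem coord_b)
      then show ?thesis by simp
    qed
    moreover have "coeffs.vanishing algebras ?X (\<lambda>\<nu> y. det (M \<nu> y))"
      unfolding coeffs.vanishing_def
    proof (intro ballI allI impI, rule ccontr)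
      fix \<nu> y assume \<nu>: "\<nu> \<in> algebras" and y: "?X \<nu> y" and det: "det (M \<nu> y) \<noteq> 0"
      interpret d: Vector_Spaces.linear scl scl "diff q \<nu> y" for q by (rule linear_diff)
      have sq: "diff 1 \<nu> y (vec1 y) = 0" and "\<not> {v \<in> B i. diff i \<nu> y v = 0} \<subseteq> diff p \<nu> y ` B p"
        using resonance_iff[OF \<nu> i, of y] y p by auto
      moreover have "Vector_Spaces.linear scl scl (\<Psi> \<nu> y)"
        unfolding Vector_Spaces.linear_iff \<Psi>_def
        by (simp add: vector_space_axioms d.add d.scale h.add h.scale k.add k.scale
            scale_right_distrib)
      then have "inj_on (\<Psi> \<nu> y) (B i)"
        using det inj_on_if_det unfolding M_def by blast
      then have "{v \<in> B i. diff i \<nu> y v = 0} \<subseteq> diff p \<nu> y ` B p"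
        using diff_mem[OF \<nu>] diff_diff[OF \<nu> sq] unfolding p \<Psi>_def
        by (intro exact_if_homotopy_inj[OF linear_diff linear_diff hk(1,3,2)]) auto
      ultimately show False by blast
    qed
    ultimately show ?thesis by (intro exI[of _ "\<lambda>\<nu> y. det (M \<nu> y)"] conjI)
  qed
qed

lemma trivial_resonance_iff:
  assumes \<mu>: "\<mu> \<in> algebras"
  shows "\<mu> \<in> trivial_resonance scl B u i \<longleftrightarrow>
    (\<forall>x. vec1 x \<in> resonance scl B (prod_of \<mu>) i 1 \<longrightarrow> (\<forall>j<N 1. x j = 0))"
proof -
  have "resonance scl B (prod_of \<mu>) i 1 \<subseteq> range vec1"
  proof
    fix a assume "a \<in> resonance scl B (prod_of \<mu>) i 1"
    then have "a \<in> B 1" by (simp add: resonance_def)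
    then show "a \<in> range vec1" using vec1_coord by (metis rangeI)
  qed
  then have "resonance scl B (prod_of \<mu>) i 1 \<subseteq> {0} \<longleftrightarrow>
      (\<forall>x. vec1 x \<in> resonance scl B (prod_of \<mu>) i 1 \<longrightarrow> vec1 x = 0)"
    by blast
  then show ?thesis
    unfolding vec1_eq_0_iff using \<mu> by (simp add: trivial_resonance_def)
qed

theorem openin_trivial_resonance:
  assumes i: "i \<ge> 1"
  shows "openin (cga_space_topology scl B u) (trivial_resonance scl B u i)"
proof -
  let ?U = "trivial_resonance scl B u i" and ?V = "mult_space scl B"
  let ?X = "\<lambda>\<mu> x. vec1 x \<in> resonance scl B (prod_of \<mu>) i 1"
  \<comment> \<open>All functions whose nonvanishing locus among the algebras stays inside
    \<open>?U\<close> are collected. The neighbourhoods found point by point thereby combine into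
    one family of equations for the complement.\<close>
  define F where "F = {f \<in> coeff_ring. \<forall>\<mu>\<in>algebras. f \<mu> \<noteq> 0 \<longrightarrow> \<mu> \<in> ?U}"
  have sub: "?U \<subseteq> algebras" "algebras \<subseteq> ?V"
    by (auto simp: trivial_resonance_def cga_space_def)
  have cone: "coeffs.conical_family algebras ?X"
    using resonance_scale[OF _ i] by (simp add: coeffs.conical_family_def)
  have pos: "\<exists>f\<in>F. f \<mu> \<noteq> 0" if \<mu>: "\<mu> \<in> ?U" for \<mu>
  proof -
    have alg: "\<mu> \<in> algebras" using \<mu> sub by blast
    have triv: "\<forall>j<N 1. x j = 0" if "?X \<mu> x" for x
      using trivial_resonance_iff[OF alg] \<mu> that by blast
    obtain f where "f \<in> coeff_ring" "f \<mu> \<noteq> 0"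
        "\<forall>\<nu>\<in>algebras. f \<nu> \<noteq> 0 \<longrightarrow> (\<forall>x. ?X \<nu> x \<longrightarrow> (\<forall>j<N 1. x j = 0))"
      using coeffs.trivial_fibres_open[OF closed_family_resonance[OF i] cone alg triv] by blast
    then show ?thesis
      unfolding F_def using trivial_resonance_iff by auto
  qed
  have neg: "\<mu> \<in> ?U" if "f \<in> F" "\<mu> \<in> algebras" "f \<mu> \<noteq> 0" for f \<mu>
    using that by (simp add: F_def)
  have "?U = (?V - zero_locus ?V F) \<inter> algebras"
    unfolding set_eq_iff Int_iff in_Diff_zero_locus using pos neg sub by blast
  moreover have "F \<subseteq> coeff_ring" by (simp add: F_def)
  then have "openin (zariski (mult_scale scl) ?V) (?V - zero_locus ?V F)"
    unfolding openin_zariski by (intro exI[of _ F] conjI refl)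
  ultimately show ?thesis
    unfolding cga_space_topology_def openin_subtopology by (intro exI conjI)
qed

end

theorem theorem3p3:
  fixes scl :: "'k::alg_closed_field \<Rightarrow> 'v::ab_group_add \<Rightarrow> 'v"
    and B :: "nat \<Rightarrow> 'v set" and u :: 'v and i :: nat
  assumes "connected_graded_space scl B u"
    and "i \<ge> 1"
  shows "openin (cga_space_topology scl B u) (trivial_resonance scl B u i)"
proof -
  obtain N b \<phi> where "graded_coordinates scl B u N b \<phi>"
    using connected_graded_space.graded_coordinates_exist[OF assms(1)] by blast
  then interpret alg_closed_graded_coordinates scl B u N b \<phi>
    by (rule alg_closed_graded_coordinates.intro)
  show ?thesis using assms(2) by (rule openin_trivial_resonance)
qed

end
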